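(* Consider the positive cross curvature flow on $E(1,1)$ for diagonal left-invariant metrics $g(t)=A(t)f^1\otimes f^1+B(t)f^2\otimes f^2+C(t)f^3\otimes f^3$, with initial data $A_0,B_0,C_0>0$, $A_0\ge C_0$. Then: - If $A_0=C_0$, the solution exists on $[0,\infty)$ and is given by $$A(t)=C(t)=\frac{A_0B_0}{\sqrt{B_0^2+64t}},\qquad B(t)=\sqrt{B_0^2+64t}.$$ - If $A_0>C_0$, there exists a positive finite time $T_b$ such that the (maximal) solution exists on $[0,T_b)$ and, as $t\to T_b$, $$A\sim\eta_1(T_b-t)^{-1/14},\quad B\sim\eta_2(T_b-t)^{3/14},\quad C\sim\eta_3(T_b-t)^{3/14}$$ with $\eta_1,\eta_2,\eta_3\in(0,\infty)$.
   Context: $E(1,1)$ (Sol) has a left-invariant frame $(f_i)$ with $[f_2,f_3]=2f_1$, $[f_3,f_1]=0$, $[f_1,f_2]=-2f_3$; $(f^i)$ is the dual frame. The positive cross curvature flow is $\partial_tg=2h$, where $h$ is the cross curvature tensor (diagonal in an orthonormal frame diagonalizing Ricci, with $h_{ii}=k_jk_l$, $k_i$ being the sectional curvature of the plane orthogonal to the $i$-th vector). It is equivalent to the ODE system, for positive functions $A,B,C$ with $(A,B,C)(0)=(A_0,B_0,C_0)$, $$\frac{dA}{dt}=\frac{2AYZ}{(ABC)^2},\quad\frac{dB}{dt}=\frac{2BZX}{(ABC)^2},\quad\frac{dC}{dt}=\frac{2CXY}{(ABC)^2},$$ $$X=(A+C)(3A-C),\quad Y=-(A+C)^2,\quad Z=-(A+C)(A-3C).$$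 The notation $u\sim v$ means $u/v\to1$. *)

theory Defs
  imports "HOL-Analysis.Analysis" "HOL-Library.Landau_Symbols"
begin

text \<open>
  Left-invariant tensor fields on \<open>E(1,1)\<close> are identified with tensors on its Lie algebra.
  The latter is \<open>\<real>\<^sup>3\<close>, where a vector lists the components with respect to the left-invariant
  frame \<open>(f\<^sub>i)\<close>; so \<open>f\<^sub>i = axis i 1\<close>, and the dual frame is \<open>f\<^sup>i u = u $ i\<close>.
\<close>

abbreviation frame :: "3 \<Rightarrow> real^3" where
  "frame i \<equiv> axis i 1"

definition bracket :: "real^3 \<Rightarrow> real^3 \<Rightarrow> real^3" where
  "bracket u v =
     (u$2 * v$3 - u$3 * v$2) *\<^sub>R (2 *\<^sub>R frame 1) + (u$1 * v$2 - u$2 * v$1) *\<^sub>R (- 2 *\<^sub>R frame 3)"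

lemma bracket_frame:
  "bracket (frame 2) (frame 3) = 2 *\<^sub>R frame 1"
  "bracket (frame 3) (frame 1) = 0"
  "bracket (frame 1) (frame 2) = - 2 *\<^sub>R frame 3"
  by (simp_all add: bracket_def axis_def)

type_synonym tensor2 = "real^3 \<Rightarrow> real^3 \<Rightarrow> real"

definition metric :: "tensor2 \<Rightarrow> bool" where
  "metric g \<longleftrightarrow> bilinear g \<and> (\<forall>u v. g u v = g v u) \<and> (\<forall>u. u \<noteq> 0 \<longrightarrow> 0 < g u u)"

definition diag_metric :: "real \<Rightarrow> real \<Rightarrow> real \<Rightarrow> tensor2" where
  "diag_metric A B C u v = A * (u$1 * v$1) + B * (u$2 * v$2) + C * (u$3 * v$3)"

text \<open>
  The Levi-Civita connection on left-invariant fields: torsion-free and compatible with \<open>g\<close>.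
  Since the function \<open>g(v, w)\<close> is constant for left-invariant \<open>v\<close>, \<open>w\<close>, compatibility has no derivative term.
\<close>

definition levi_civita :: "tensor2 \<Rightarrow> real^3 \<Rightarrow> real^3 \<Rightarrow> real^3" where
  "levi_civita g = (THE D. bilinear D
      \<and> (\<forall>u v. D u v - D v u = bracket u v)
      \<and> (\<forall>u v w. g (D u v) w + g v (D u w) = 0))"

definition riemann :: "tensor2 \<Rightarrow> real^3 \<Rightarrow> real^3 \<Rightarrow> real^3 \<Rightarrow> real^3" where
  "riemann g u v w = (let D = levi_civita g in D u (D v w) - D v (D u w) - D (bracket u v) w)"

definition sectional :: "tensor2 \<Rightarrow> real^3 \<Rightarrow> real^3 \<Rightarrow> real" where
  "sectional g u v = g (riemann g u v v) u / (g u u * g v v - (g u v)\<^sup>2)"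

text \<open>\<open>Ric(u, v)\<close> is the trace of \<open>w \<mapsto> R(w, u) v\<close>.\<close>

definition ricci :: "tensor2 \<Rightarrow> tensor2" where
  "ricci g u v = (\<Sum>i\<in>UNIV. riemann g (frame i) u v $ i)"

definition orthonormal_frame :: "tensor2 \<Rightarrow> (3 \<Rightarrow> real^3) \<Rightarrow> bool" where
  "orthonormal_frame g e \<longleftrightarrow> (\<forall>i j. g (e i) (e j) = (if i = j then 1 else 0))"

text \<open>
  Arithmetic in the index type \<open>3\<close> is modulo 3, so \<open>i + 1\<close> and \<open>i + 2\<close> are the two indices
  other than \<open>i\<close>.
\<close>

definition opposite_sectional :: "tensor2 \<Rightarrow> (3 \<Rightarrow> real^3) \<Rightarrow> 3 \<Rightarrow> real" where
  "opposite_sectional g e i = sectional g (e (i + 1)) (e (i + 2))"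

definition cross_curvature :: "tensor2 \<Rightarrow> tensor2 \<Rightarrow> bool" where
  "cross_curvature g h \<longleftrightarrow> bilinear h \<and> (\<exists>e. orthonormal_frame g e
      \<and> (\<forall>i j. i \<noteq> j \<longrightarrow> ricci g (e i) (e j) = 0)
      \<and> (\<forall>i j. h (e i) (e j) =
           (if i = j then opposite_sectional g e (i + 1) * opposite_sectional g e (i + 2) else 0)))"

text \<open>The positive cross curvature flow \<open>\<partial>\<^sub>t g = 2 h\<close> on a time set \<open>J\<close> (one-sided at end points).\<close>

definition positive_xcf_on :: "real set \<Rightarrow> (real \<Rightarrow> tensor2) \<Rightarrow> bool" where
  "positive_xcf_on J g \<longleftrightarrow> (\<forall>t\<in>J. metric (g t) \<and> (\<exists>h. cross_curvature (g t) h \<and>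
      (\<forall>u v. ((\<lambda>s. g s u v) has_real_derivative 2 * h u v) (at t within J))))"

definition time_interval :: "ereal \<Rightarrow> real set" where
  "time_interval T = {t. 0 \<le> t \<and> ereal t < T}"

definition diag_solution ::
  "real \<Rightarrow> real \<Rightarrow> real \<Rightarrow> ereal \<Rightarrow> (real \<Rightarrow> real) \<Rightarrow> (real \<Rightarrow> real) \<Rightarrow> (real \<Rightarrow> real) \<Rightarrow> bool" where
  "diag_solution A0 B0 C0 T A B C \<longleftrightarrow> 0 < T \<and> A 0 = A0 \<and> B 0 = B0 \<and> C 0 = C0
     \<and> positive_xcf_on (time_interval T) (\<lambda>t. diag_metric (A t) (B t) (C t))"

text \<open>
  The maximal solution extends every other solution with the same initial data; this includes
  uniqueness, on \<open>[0, T)\<close> as well as on each shorter interval.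
\<close>

definition maximal_diag_solution ::
  "real \<Rightarrow> real \<Rightarrow> real \<Rightarrow> ereal \<Rightarrow> (real \<Rightarrow> real) \<Rightarrow> (real \<Rightarrow> real) \<Rightarrow> (real \<Rightarrow> real) \<Rightarrow> bool" where
  "maximal_diag_solution A0 B0 C0 T A B C \<longleftrightarrow> diag_solution A0 B0 C0 T A B C
     \<and> (\<forall>T' A' B' C'. diag_solution A0 B0 C0 T' A' B' C' \<longrightarrow>
          T' \<le> T \<and> (\<forall>t\<in>time_interval T'. A' t = A t \<and> B' t = B t \<and> C' t = C t))"

end

theory Submission
  imports Defs
begin

text \<open>
  The Koszul formula gives the Levi-Civita connection of a diagonal metric. Its curvature operator is
  diagonal in the frame \<open>(f\<^sub>i)\<close>, and the cross curvature tensor is the adjugate of the matrix of sectional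
  curvatures, so that it does not depend on the orthonormal frame diagonalizing Ricci. The flow is thus
  equivalent to the ODE system.

  The ODE system has the first integrals \<open>A C (A - C)\<^sup>2\<close> and \<open>B\<^sup>2 (A + C)\<^sup>4 / (A C)\<close>. If \<open>A = C\<close> initially, the
  first one vanishes, so \<open>A = C\<close> throughout and \<open>(B\<^sup>2)' = 64\<close>. Otherwise the two integrals express \<open>A, B, C\<close>
  through \<open>s = (C / A)\<^bsup>1/4\<^esup>\<close>, which solves \<open>s\<^bsup>13\<^esup> (1 + s\<^sup>4)\<^bsup>-7\<^esup> s' = - c\<close> with a constant \<open>c > 0\<close>. Integration
  gives existence and uniqueness, a finite time at which \<open>s\<close> reaches \<open>0\<close>, and \<open>s\<^bsup>14\<^esup> \<sim> 14 c (T\<^sub>b - t)\<close>; finally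
  \<open>A\<close>, \<open>B\<close>, \<open>C\<close> are asymptotic to multiples of \<open>1/s\<close>, \<open>s\<^sup>3\<close>, \<open>s\<^sup>3\<close>.
\<close>

section \<open>Geometry of diagonal metrics\<close>

lemma bilinear_diag_metric: "bilinear (diag_metric A B C)"
  unfolding bilinear_def diag_metric_def by (auto intro!: linearI simp: algebra_simps)

lemma metric_diag_iff: "metric (diag_metric A B C) \<longleftrightarrow> 0 < A \<and> 0 < B \<and> 0 < C"
proof
  assume m: "metric (diag_metric A B C)"
  have "0 < diag_metric A B C (frame i) (frame i)" for i
    using m by (simp add: metric_def axis_eq_0_iff)
  from this[of 1] this[of 2] this[of 3] show "0 < A \<and> 0 < B \<and> 0 < C"
    by (simp add: diag_metric_def axis_def)
next
  assume p: "0 < A \<and> 0 < B \<and> 0 < C"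
  have "0 < diag_metric A B C u u" if "u \<noteq> 0" for u
  proof -
    have "u$1 \<noteq> 0 \<or> u$2 \<noteq> 0 \<or> u$3 \<noteq> 0"
      using that by (auto simp: vec_eq_iff forall_3)
    then show ?thesis
      using p unfolding diag_metric_def
      by (smt (verit) mult_pos_pos not_real_square_gt_zero zero_le_mult_iff)
  qed
  then show "metric (diag_metric A B C)"
    by (auto simp: metric_def bilinear_diag_metric) (simp add: diag_metric_def)
qed

section \<open>Levi-Civita connection and curvature\<close>

definition diag_connection :: "real \<Rightarrow> real \<Rightarrow> real \<Rightarrow> real^3 \<Rightarrow> real^3 \<Rightarrow> real^3" where
  "diag_connection A B C u v = vector
     [((A - C) * (u$2 * v$3) - (A + C) * (u$3 * v$2)) / A,
      (A + C) * (u$1 * v$3 + u$3 * v$1) / B,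
      - ((A + C) * (u$1 * v$2) + (A - C) * (u$2 * v$1)) / C]"

lemma bracket_nth:
  "bracket u v $ 1 = 2 * (u$2 * v$3 - u$3 * v$2)"
  "bracket u v $ 2 = 0"
  "bracket u v $ 3 = - 2 * (u$1 * v$2 - u$2 * v$1)"
  by (simp_all add: bracket_def axis_def)

text \<open>The definite description needs existence and uniqueness. Existence is a direct check;
  uniqueness follows from the Koszul formula, which expresses \<open>g (D u v) w\<close> through
  brackets alone.\<close>

lemma levi_civita_diag:
  assumes "0 < A" "0 < B" "0 < C"
  shows "levi_civita (diag_metric A B C) = diag_connection A B C"
  unfolding levi_civita_def
proof (rule the_equality)
  let ?g = "diag_metric A B C"
  have "bilinear (diag_connection A B C)"
    unfolding bilinear_def diag_connection_def
    by (auto intro!: linearI simp: vec_eq_iff forall_3 algebra_simps add_divide_distrib diff_divide_distrib)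
  then show "bilinear (diag_connection A B C) \<and>
    (\<forall>u v. diag_connection A B C u v - diag_connection A B C v u = bracket u v) \<and>
    (\<forall>u v w. ?g (diag_connection A B C u v) w + ?g v (diag_connection A B C u w) = 0)"
    using assms
    by (simp add: vec_eq_iff forall_3 bracket_nth diag_connection_def diag_metric_def)
       (auto simp: field_simps)
next
  let ?g = "diag_metric A B C"
  fix D
  assume D: "bilinear D \<and> (\<forall>u v. D u v - D v u = bracket u v)
      \<and> (\<forall>u v w. ?g (D u v) w + ?g v (D u w) = 0)"
  have g_add: "?g (x - y) z = ?g x z - ?g y z" for x y z
    by (simp add: diag_metric_def algebra_simps)
  have g_sym: "?g x y = ?g y x" for x y
    by (simp add: diag_metric_def)
  \<comment> \<open>Torsion-freeness turns each bracket into a difference of values of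
    \<open>D\<close>; compatibility, used once for each of the directions \<open>u\<close>,
    \<open>v\<close>, \<open>w\<close>, cancels everything except two copies of
    \<open>?g (D u v) w\<close>.\<close>
  have koszul: "2 * ?g (D u v) w = ?g (bracket u v) w - ?g (bracket v w) u + ?g (bracket w u) v" for u v w
  proof -
    have t: "?g (bracket x y) z = ?g (D x y) z - ?g (D y x) z" for x y z
      using D by (metis g_add)
    have c: "?g (D x y) z + ?g (D x z) y = 0" for x y z
      using D g_sym by metis
    show ?thesis
      using c[of u v w] c[of v u w] c[of w u v] by (simp add: t)
  qed
  have k: "2 * ?g (D u v) (frame i) = 2 * ?g (diag_connection A B C u v) (frame i)" for u v i
    unfolding koszul using assms exhaust_3[of i]
    by (auto simp: diag_metric_def diag_connection_def bracket_nth axis_def field_simps)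
  have "D u v $ i = diag_connection A B C u v $ i" for u v i
    using k[of u v i] exhaust_3[of i] assms
    by (auto simp: diag_metric_def axis_def)
  then show "D = diag_connection A B C"
    by (simp add: fun_eq_iff vec_eq_iff)
qed

text \<open>In the notation of the ODE system these are \<open>- X\<close>, \<open>- Y\<close>,
  \<open>- Z\<close> divided by \<open>A * B * C\<close>: the sectional curvatures of the planes
  orthogonal to the frame vectors.\<close>

definition diag_sectional :: "real \<Rightarrow> real \<Rightarrow> real \<Rightarrow> 3 \<Rightarrow> real" where
  "diag_sectional A B C i =
     (if i = 1 then - ((A + C) * (3 * A - C))
      else if i = 2 then (A + C)\<^sup>2 else (A + C) * (A - 3 * C)) / (A * B * C)"

lemma diag_sectional_simps:
  "diag_sectional A B C 1 = - ((A + C) * (3 * A - C)) / (A * B * C)"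
  "diag_sectional A B C 2 = (A + C)\<^sup>2 / (A * B * C)"
  "diag_sectional A B C 3 = (A + C) * (A - 3 * C) / (A * B * C)"
  by (simp_all add: diag_sectional_def)

text \<open>The vectors \<open>u\<close> and \<open>v\<close> enter only through their 2 x 2 minors,
  the coordinates of their wedge product, and each minor comes with its own \<open>K i\<close>: the
  curvature operator is diagonal on the coordinate planes.\<close>

lemma riemann_diag:
  assumes "0 < A" "0 < B" "0 < C"
  defines "K \<equiv> diag_sectional A B C"
  shows "riemann (diag_metric A B C) u v w = vector
    [K 3 * B * (u$1 * v$2 - u$2 * v$1) * w$2 - K 2 * C * (u$3 * v$1 - u$1 * v$3) * w$3,
     K 1 * C * (u$2 * v$3 - u$3 * v$2) * w$3 - K 3 * A * (u$1 * v$2 - u$2 * v$1) * w$1,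
     K 2 * A * (u$3 * v$1 - u$1 * v$3) * w$1 - K 1 * B * (u$2 * v$3 - u$3 * v$2) * w$2]"
  using assms(1-3) unfolding riemann_def Let_def levi_civita_diag[OF assms(1-3)] K_def
  apply (simp add: vec_eq_iff forall_3 diag_connection_def bracket_nth diag_sectional_simps)
  apply (intro conjI; simp add: divide_simps; simp add: algebra_simps power2_eq_square)
  done

lemma ricci_diag:
  assumes "0 < A" "0 < B" "0 < C"
  defines "K \<equiv> diag_sectional A B C"
  shows "ricci (diag_metric A B C) u v =
    A * (K 2 + K 3) * (u$1 * v$1) + B * (K 1 + K 3) * (u$2 * v$2) + C * (K 1 + K 2) * (u$3 * v$3)"
  unfolding ricci_def riemann_diag[OF assms(1-3)] K_def[symmetric]
  by (simp add: sum_3 axis_def algebra_simps)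

text \<open>The numerator of the sectional curvature is a quadratic form in the minors; the weights
  \<open>B * C\<close>, \<open>C * A\<close>, \<open>A * B\<close> are the squared areas of the
  coordinate parallelograms.\<close>

lemma diag_metric_riemann:
  assumes "0 < A" "0 < B" "0 < C"
  defines "K \<equiv> diag_sectional A B C"
  shows "diag_metric A B C (riemann (diag_metric A B C) u v v) u =
    K 1 * (B * C) * (u$2 * v$3 - u$3 * v$2)\<^sup>2 + K 2 * (C * A) * (u$3 * v$1 - u$1 * v$3)\<^sup>2
    + K 3 * (A * B) * (u$1 * v$2 - u$2 * v$1)\<^sup>2"
  unfolding riemann_diag[OF assms(1-3)] K_def[symmetric] diag_metric_def
  by (simp add: algebra_simps power2_eq_square)

section \<open>Orthogonal 3 x 3 matrices and cyclic indices\<close>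

lemma exhaust_3_shift: "j = i \<or> j = i + 1 \<or> j = i + (2::3)"
proof -
  have "(3::3) = 0" "(4::3) = 1" "(5::3) = 2" by simp_all
  then show ?thesis using exhaust_3[of i] exhaust_3[of j] by auto
qed

lemma sum_3_shift: "sum f UNIV = f i + f (i + 1) + f (i + (2::3))" for f :: "3 \<Rightarrow> 'a::comm_monoid_add"
proof -
  have "(UNIV :: 3 set) = {i, i + 1, i + 2}"
    using exhaust_3_shift by blast
  then have "sum f UNIV = sum f {i, i + 1, i + 2}"
    by (rule arg_cong)
  also have "\<dots> = f i + f (i + 1) + f (i + 2)"
    by (simp add: add.assoc)
  finally show ?thesis .
qed

text \<open>A one-sided inverse of a square matrix is two-sided, so orthonormal rows force
  orthonormal columns.\<close>

lemma orthonormal_columns: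
  fixes M :: "real^'n^'n"
  assumes "\<And>i j. (\<Sum>k\<in>UNIV. M$i$k * M$j$k) = (if i = j then 1 else 0)"
  shows "(\<Sum>i\<in>UNIV. M$i$k * M$i$l) = (if k = l then 1 else 0)"
proof -
  have "M ** transpose M = mat 1"
    using assms by (simp add: vec_eq_iff matrix_matrix_mult_def transpose_def mat_def)
  then have "transpose M ** M = mat 1"
    by (simp add: matrix_left_right_inverse)
  then show ?thesis
    by (simp add: vec_eq_iff matrix_matrix_mult_def transpose_def mat_def)
qed

text \<open>
  Repeated entries of \<open>K\<close> do no harm: \<open>\<kappa> i = K k\<close> whenever \<open>M$i$k \<noteq> 0\<close>, and the product of the other
  two entries is then determined by the common trace and the common sum of squares.
\<close>

lemma adjugate_diagonalized:
  fixes M :: "real^3^3" and K \<kappa> :: "3 \<Rightarrow> real"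
  assumes orth: "\<And>i j. (\<Sum>k\<in>UNIV. M$i$k * M$j$k) = (if i = j then 1 else 0)"
    and diag: "\<And>i j. (\<Sum>k\<in>UNIV. K k * (M$i$k * M$j$k)) = (if i = j then \<kappa> i else 0)"
  shows "(\<Sum>i\<in>UNIV. \<kappa> (i + 1) * \<kappa> (i + 2) * (M$i$k * M$i$l))
    = (if k = l then K (k + 1) * K (k + 2) else 0)"
proof -
  note col = orthonormal_columns[OF orth]
  \<comment> \<open>In matrix form \<open>diag\<close> reads
    \<open>M diag(K) transpose(M) = diag(\<kappa>)\<close>; multiplication by \<open>M\<close> from
    the right gives \<open>M diag(K) = diag(\<kappa>) M\<close>, entry by entry.\<close>
  have eig: "K l * M$i$l = \<kappa> i * M$i$l" for i l
  proof -
    have "\<kappa> i * M$i$l = (\<Sum>j\<in>UNIV. (\<Sum>k\<in>UNIV. K k * (M$i$k * M$j$k)) * M$j$l)"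
      unfolding diag by (simp add: if_distrib[of "\<lambda>x. x * _"] sum.delta cong: if_cong)
    also have "\<dots> = (\<Sum>k\<in>UNIV. K k * M$i$k * (\<Sum>j\<in>UNIV. M$j$k * M$j$l))"
      unfolding sum_distrib_left sum_distrib_right by (subst sum.swap) (simp add: mult_ac)
    also have "\<dots> = K l * M$i$l"
      unfolding col by (simp add: if_distrib[of "\<lambda>x. _ * x"] sum.delta cong: if_cong)
    finally show ?thesis ..
  qed
  have tr: "sum \<kappa> UNIV = sum K UNIV"
  proof -
    have "sum \<kappa> UNIV = (\<Sum>i\<in>UNIV. \<Sum>k\<in>UNIV. K k * (M$i$k * M$i$k))"
      unfolding diag by simp
    also have "\<dots> = (\<Sum>k\<in>UNIV. K k * (\<Sum>i\<in>UNIV. M$i$k * M$i$k))"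
      unfolding sum_distrib_left by (rule sum.swap)
    finally show ?thesis unfolding col by simp
  qed
  have tr2: "(\<Sum>i\<in>UNIV. (\<kappa> i)\<^sup>2) = (\<Sum>i\<in>UNIV. (K i)\<^sup>2)"
  proof -
    have "(\<Sum>i\<in>UNIV. (\<kappa> i)\<^sup>2) = (\<Sum>i\<in>UNIV. \<kappa> i * (\<Sum>k\<in>UNIV. K k * (M$i$k * M$i$k)))"
      unfolding diag by (simp add: power2_eq_square)
    also have "\<dots> = (\<Sum>i\<in>UNIV. \<Sum>k\<in>UNIV. (K k)\<^sup>2 * (M$i$k * M$i$k))"
    proof -
      have "\<kappa> i * (K k * (M$i$k * M$i$k)) = (K k)\<^sup>2 * (M$i$k * M$i$k)" for i k
        using eig[of k i] by (simp add: power2_eq_square mult_ac) (metis mult.left_commute)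
      then show ?thesis by (simp only: sum_distrib_left)
    qed
    also have "\<dots> = (\<Sum>k\<in>UNIV. (K k)\<^sup>2 * (\<Sum>i\<in>UNIV. M$i$k * M$i$k))"
      unfolding sum_distrib_left by (rule sum.swap)
    finally show ?thesis unfolding col by simp
  qed
  have "\<kappa> (i + 1) * \<kappa> (i + 2) * M$i$k = K (k + 1) * K (k + 2) * M$i$k" for i
  proof (cases "M$i$k = 0")
    case False
    then have "K k = \<kappa> i" using eig[of k i] by simp
    moreover have "\<kappa> i + \<kappa> (i + 1) + \<kappa> (i + 2) = K k + K (k + 1) + K (k + 2)"
      using tr unfolding sum_3_shift[of \<kappa> i] sum_3_shift[of K k] .
    moreover have "(\<kappa> i)\<^sup>2 + (\<kappa> (i + 1))\<^sup>2 + (\<kappa> (i + 2))\<^sup>2 = (K k)\<^sup>2 + (K (k + 1))\<^sup>2 + (K (k + 2))\<^sup>2"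
      using tr2 unfolding sum_3_shift[of _ i, where f="\<lambda>i. (\<kappa> i)\<^sup>2"] sum_3_shift[of _ k, where f="\<lambda>i. (K i)\<^sup>2"] .
    ultimately have *: "\<kappa> (i + 1) + \<kappa> (i + 2) = K (k + 1) + K (k + 2)"
      "(\<kappa> (i + 1))\<^sup>2 + (\<kappa> (i + 2))\<^sup>2 = (K (k + 1))\<^sup>2 + (K (k + 2))\<^sup>2"
      by simp_all
    have "2 * (x * y) = (x + y)\<^sup>2 - (x\<^sup>2 + y\<^sup>2)" for x y :: real
      by (simp add: power2_sum)
    with * have "\<kappa> (i + 1) * \<kappa> (i + 2) = K (k + 1) * K (k + 2)"
      by (metis mult_cancel_left zero_neq_numeral)
    then show ?thesis by simp
  qed simp
  then have "(\<Sum>i\<in>UNIV. \<kappa> (i + 1) * \<kappa> (i + 2) * (M$i$k * M$i$l))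
      = (\<Sum>i\<in>UNIV. K (k + 1) * K (k + 2) * (M$i$k * M$i$l))"
    by (simp only: mult.assoc[symmetric])
  also have "\<dots> = (if k = l then K (k + 1) * K (k + 2) else 0)"
    unfolding sum_distrib_left[symmetric] col by simp
  finally show ?thesis .
qed

text \<open>The cross product of two rows of an orthogonal matrix is the third row up to sign, and
  squaring removes the sign.\<close>

lemma orthogonal_matrix_minor_squared:
  fixes M :: "real^3^3"
  assumes orth: "\<And>i j. (\<Sum>k\<in>UNIV. M$i$k * M$j$k) = (if i = j then 1 else 0)"
  shows "(M$(i+1)$(k+1) * M$(i+2)$(k+2) - M$(i+1)$(k+2) * M$(i+2)$(k+1))\<^sup>2 = (M$i$k)\<^sup>2"
proof -
  have c: "M$i$k * M$i$l + M$(i+1)$k * M$(i+1)$l + M$(i+2)$k * M$(i+2)$l = (if k = l then 1 else 0)" for k l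
    using orthonormal_columns[OF orth, of k l] unfolding sum_3_shift[of _ i] .
  have r: "M$i$k * M$i$k + M$i$(k+1) * M$i$(k+1) + M$i$(k+2) * M$i$(k+2) = 1"
    using orth[of i i] unfolding sum_3_shift[of _ k] by simp
  show ?thesis
    \<comment> \<open>Lagrange's identity for the columns \<open>k+1\<close> and \<open>k+2\<close>
      with row \<open>i\<close> deleted: \<open>c\<close> supplies their squared lengths and inner
      product, so the squared minor is 1 minus the squares of \<open>M$i$(k+1)\<close> and
      \<open>M$i$(k+2)\<close>, and \<open>r\<close> finishes.\<close>
    using c[of "k+1" "k+1"] c[of "k+2" "k+2"] c[of "k+1" "k+2"] r
    by (simp; algebra)
qed

section \<open>The cross curvature tensor of a diagonal metric\<close>

definition diag_cross :: "real \<Rightarrow> real \<Rightarrow> real \<Rightarrow> tensor2" where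
  "diag_cross A B C = (let K = diag_sectional A B C in
     diag_metric (A * (K 2 * K 3)) (B * (K 3 * K 1)) (C * (K 1 * K 2)))"

lemma numeral_mod_3 [simp]: "(4::3) = 1" "(5::3) = 2"
  by simp_all

text \<open>The definition admits every orthonormal frame diagonalizing Ricci. Relative to the
  normalized left-invariant frame such a frame is an orthogonal matrix that also diagonalizes the
  sectional curvatures, and the adjugate transforms along with it.\<close>

lemma cross_curvature_diag_unique:
  assumes "0 < A" "0 < B" "0 < C"
    and h: "cross_curvature (diag_metric A B C) h"
  shows "h = diag_cross A B C"
proof -
  let ?g = "diag_metric A B C"
  define K where "K = diag_sectional A B C"
  \<comment> \<open>\<open>q k\<close> is the length of \<open>frame k\<close>, so the rows of
    \<open>M\<close> below are the coordinates of the \<open>e i\<close> in the normalized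
    left-invariant frame.\<close>
  define q :: "3 \<Rightarrow> real" where "q i = sqrt (if i = 1 then A else if i = 2 then B else C)" for i
  have q: "q i > 0" for i using assms by (simp add: q_def)
  have q2: "q 1 * q 1 = A" "q 2 * q 2 = B" "q 3 * q 3 = C" using assms by (simp_all add: q_def)
  obtain e where bil: "bilinear h" and e: "orthonormal_frame ?g e"
    and ric: "\<And>i j. i \<noteq> j \<Longrightarrow> ricci ?g (e i) (e j) = 0"
    and he: "\<And>i j. h (e i) (e j) =
        (if i = j then opposite_sectional ?g e (i + 1) * opposite_sectional ?g e (i + 2) else 0)"
    using h unfolding cross_curvature_def by blast
  define M :: "real^3^3" where "M = (\<chi> i k. q k * e i $ k)"
  have M: "M$i$k = q k * e i $ k" for i k by (simp add: M_def)
  have g_M: "?g (e i) (e j) = (\<Sum>k\<in>UNIV. M$i$k * M$j$k)" for i j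
    by (simp add: diag_metric_def sum_3 M q2[symmetric])
  have orth: "(\<Sum>k\<in>UNIV. M$i$k * M$j$k) = (if i = j then 1 else 0)" for i j
    using e unfolding g_M[symmetric] orthonormal_frame_def by blast
  define \<kappa> where "\<kappa> = opposite_sectional ?g e"
  have \<kappa>: "\<kappa> i = (\<Sum>k\<in>UNIV. K k * (M$i$k * M$i$k))" for i
  proof -
    \<comment> \<open>Distinct indices give two orthonormal vectors, so the denominator in
      \<open>sectional\<close> equals 1.\<close>
    have "i + 1 \<noteq> i + 2" by simp
    then have "\<kappa> i = ?g (riemann ?g (e (i+1)) (e (i+2)) (e (i+2))) (e (i+1))"
      using e by (simp add: \<kappa>_def opposite_sectional_def sectional_def orthonormal_frame_def)
    also have "\<dots> = (\<Sum>k\<in>UNIV. K k * (M$(i+1)$(k+1) * M$(i+2)$(k+2) - M$(i+1)$(k+2) * M$(i+2)$(k+1))\<^sup>2)"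
      unfolding diag_metric_riemann[OF assms(1-3)] K_def[symmetric]
      by (simp add: sum_3 M flip: q2) (simp add: power2_eq_square algebra_simps)
    finally show ?thesis
      unfolding orthogonal_matrix_minor_squared[OF orth] by (simp add: power2_eq_square)
  qed
  have "(\<Sum>k\<in>UNIV. K k * (M$i$k * M$j$k)) = (if i = j then \<kappa> i else 0)" for i j
  proof (cases "i = j")
    case False
    \<comment> \<open>In dimension three Ricci is the trace of \<open>K\<close> times the metric
      minus the form with eigenvalues \<open>K\<close>. Off the diagonal the metric term vanishes,
      so diagonalizing Ricci diagonalizes \<open>K\<close>.\<close>
    have "ricci ?g (e i) (e j) = (K 1 + K 2 + K 3) * (\<Sum>k\<in>UNIV. M$i$k * M$j$k) - (\<Sum>k\<in>UNIV. K k * (M$i$k * M$j$k))"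
      unfolding ricci_diag[OF assms(1-3)] K_def[symmetric]
      by (simp add: sum_3 M algebra_simps flip: q2)
    then show ?thesis using False ric orth[of i j] by simp
  qed (simp add: \<kappa>)
  note adj = adjugate_diagonalized[OF orth this]
  have frame: "frame k = (\<Sum>i\<in>UNIV. (q k * M$i$k) *\<^sub>R e i)" for k
  proof -
    have "(\<Sum>i\<in>UNIV. (q k * M$i$k) *\<^sub>R e i) $ l = q k / q l * (\<Sum>i\<in>UNIV. M$i$k * M$i$l)" for l
      using q[of l] by (simp add: sum_distrib_left M mult_ac)
    then show ?thesis
      unfolding orthonormal_columns[OF orth] using q[of k] by (auto simp: vec_eq_iff axis_def)
  qed
  have "h (frame k) (frame l) = diag_cross A B C (frame k) (frame l)" for k l
  proof -
    have "h (frame k) (frame l) = (\<Sum>i\<in>UNIV. \<Sum>j\<in>UNIV. (q k * M$i$k) * ((q l * M$j$l) * h (e i) (e j)))"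
      unfolding frame[of k] frame[of l] bilinear_sum[OF bil] sum.cartesian_product[symmetric]
      by (simp add: bilinear_lmul[OF bil] bilinear_rmul[OF bil] mult_ac)
    also have "\<dots> = (\<Sum>i\<in>UNIV. (q k * M$i$k) * ((q l * M$i$l) * (\<kappa> (i+1) * \<kappa> (i+2))))"
      unfolding he \<kappa>_def[symmetric] by (simp add: if_distrib[of "\<lambda>x. _ * x"] sum.delta cong: if_cong)
    also have "\<dots> = q k * q l * (\<Sum>i\<in>UNIV. \<kappa> (i + 1) * \<kappa> (i + 2) * (M$i$k * M$i$l))"
      unfolding sum_distrib_left by (simp add: mult_ac)
    also have "\<dots> = (if k = l then q k * q k * (K (k + 1) * K (k + 2)) else 0)"
      unfolding adj by simp
    also have "\<dots> = diag_cross A B C (frame k) (frame l)"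
      using exhaust_3[of k] exhaust_3[of l] q2
      by (auto simp: diag_cross_def K_def Let_def diag_metric_def axis_def)
    finally show ?thesis .
  qed
  then show ?thesis
    using bilinear_eq_stdbasis[OF bil, of "diag_cross A B C"]
    by (auto simp: Basis_vec_def diag_cross_def Let_def bilinear_diag_metric fun_eq_iff)
qed

text \<open>The normalized left-invariant frame is a witness; undoing the normalization produces the
  factors \<open>A\<close>, \<open>B\<close>, \<open>C\<close> in \<open>diag_cross\<close>.\<close>

lemma cross_curvature_diag:
  assumes "0 < A" "0 < B" "0 < C"
  shows "cross_curvature (diag_metric A B C) (diag_cross A B C)"
proof -
  let ?g = "diag_metric A B C"
  define q :: "3 \<Rightarrow> real" where "q i = sqrt (if i = 1 then A else if i = 2 then B else C)" for i
  have q: "q 1 > 0" "q 2 > 0" "q 3 > 0" using assms by (simp_all add: q_def)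
  have q2: "A = q 1 * q 1" "B = q 2 * q 2" "C = q 3 * q 3" using assms by (simp_all add: q_def)
  define e where "e i = (1 / q i) *\<^sub>R (frame i :: real^3)" for i
  have e: "orthonormal_frame ?g e"
    unfolding orthonormal_frame_def forall_3 using q
    by (simp add: diag_metric_def e_def axis_def q2)
  have ric: "\<forall>i j. i \<noteq> j \<longrightarrow> ricci ?g (e i) (e j) = 0"
    unfolding forall_3 ricci_diag[OF assms] by (simp add: e_def axis_def)
  have "opposite_sectional ?g e i = ?g (riemann ?g (e (i+1)) (e (i+2)) (e (i+2))) (e (i+1))" for i
  proof -
    have "i + 1 \<noteq> i + 2" by simp
    then show ?thesis
      using e by (simp add: opposite_sectional_def sectional_def orthonormal_frame_def)
  qed
  moreover have "\<forall>i. ?g (riemann ?g (e (i+1)) (e (i+2)) (e (i+2))) (e (i+1)) = diag_sectional A B C i"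
    unfolding diag_metric_riemann[OF assms] forall_3
    using q by (simp add: e_def axis_def power2_eq_square) (simp add: q2)
  ultimately have opp: "opposite_sectional ?g e = diag_sectional A B C"
    by auto
  have "\<forall>i j. diag_cross A B C (e i) (e j) =
      (if i = j then diag_sectional A B C (i + 1) * diag_sectional A B C (i + 2) else 0)"
    unfolding forall_3 using q 
    by (simp add: diag_cross_def Let_def diag_metric_def e_def axis_def) (simp add: q2)
  then show ?thesis
    unfolding cross_curvature_def using e ric unfolding opp[symmetric]
    by (auto simp: diag_cross_def Let_def bilinear_diag_metric)
qed

section \<open>The flow as an ODE system\<close>

text \<open>Each of \<open>Y Z\<close>, \<open>Z X\<close>, \<open>X Y\<close> contains
  \<open>(A + C)\<^sup>2\<close>. With this common rate split off, the relative growth of each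
  coefficient is a quadratic form in \<open>A\<close> and \<open>C\<close>.\<close>

definition xcf_rate :: "real \<Rightarrow> real \<Rightarrow> real \<Rightarrow> real" where
  "xcf_rate A B C = 2 * (A + C)\<^sup>2 / (A * B * C)\<^sup>2"

definition xcf_ode_on :: "real set \<Rightarrow> (real \<Rightarrow> real) \<Rightarrow> (real \<Rightarrow> real) \<Rightarrow> (real \<Rightarrow> real) \<Rightarrow> bool" where
  "xcf_ode_on J A B C \<longleftrightarrow> (\<forall>t\<in>J. 0 < A t \<and> 0 < B t \<and> 0 < C t
    \<and> (A has_real_derivative A t * xcf_rate (A t) (B t) (C t) * ((A t + C t) * (A t - 3 * C t))) (at t within J)
    \<and> (B has_real_derivative - B t * xcf_rate (A t) (B t) (C t) * ((A t - 3 * C t) * (3 * A t - C t))) (at t within J)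
    \<and> (C has_real_derivative - C t * xcf_rate (A t) (B t) (C t) * ((A t + C t) * (3 * A t - C t))) (at t within J))"

text \<open>Existence and uniqueness of the cross curvature replace the quantified \<open>h\<close>
  by \<open>diag_cross\<close>. Testing on the frame vectors then gives the three scalar equations;
  linearity gives the converse.\<close>

lemma positive_xcf_on_diag_iff:
  "positive_xcf_on J (\<lambda>t. diag_metric (A t) (B t) (C t)) \<longleftrightarrow> xcf_ode_on J A B C"
proof -
  have "(\<exists>h. cross_curvature (diag_metric (A t) (B t) (C t)) h \<and>
      (\<forall>u v. ((\<lambda>s. diag_metric (A s) (B s) (C s) u v) has_real_derivative 2 * h u v) (at t within J)))
    \<longleftrightarrow> (A has_real_derivative A t * xcf_rate (A t) (B t) (C t) * ((A t + C t) * (A t - 3 * C t))) (at t within J)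
    \<and> (B has_real_derivative - B t * xcf_rate (A t) (B t) (C t) * ((A t - 3 * C t) * (3 * A t - C t))) (at t within J)
    \<and> (C has_real_derivative - C t * xcf_rate (A t) (B t) (C t) * ((A t + C t) * (3 * A t - C t))) (at t within J)"
    (is "?l \<longleftrightarrow> ?r") if pos: "0 < A t" "0 < B t" "0 < C t" for t
  proof -
    let ?h = "diag_cross (A t) (B t) (C t)"
    define K where "K = diag_sectional (A t) (B t) (C t)"
    have r: "A t * xcf_rate (A t) (B t) (C t) * ((A t + C t) * (A t - 3 * C t)) = 2 * (A t * (K 2 * K 3))"
      "- B t * xcf_rate (A t) (B t) (C t) * ((A t - 3 * C t) * (3 * A t - C t)) = 2 * (B t * (K 3 * K 1))"
      "- C t * xcf_rate (A t) (B t) (C t) * ((A t + C t) * (3 * A t - C t)) = 2 * (C t * (K 1 * K 2))"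
      by (simp_all add: K_def diag_sectional_simps xcf_rate_def power2_eq_square)
    have h: "2 * ?h u v = 2 * (A t * (K 2 * K 3)) * (u$1 * v$1) + 2 * (B t * (K 3 * K 1)) * (u$2 * v$2)
        + 2 * (C t * (K 1 * K 2)) * (u$3 * v$3)" for u v
      by (simp add: diag_cross_def K_def Let_def diag_metric_def algebra_simps)
    have "?l \<longleftrightarrow> (\<forall>u v. ((\<lambda>s. diag_metric (A s) (B s) (C s) u v) has_real_derivative 2 * ?h u v) (at t within J))"
      using cross_curvature_diag[OF pos] cross_curvature_diag_unique[OF pos] by blast
    also have "\<dots> \<longleftrightarrow> ?r"
    proof
      assume d: "\<forall>u v. ((\<lambda>s. diag_metric (A s) (B s) (C s) u v) has_real_derivative 2 * ?h u v) (at t within J)"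
      have "((\<lambda>s. diag_metric (A s) (B s) (C s) (frame i) (frame i)) has_real_derivative 2 * ?h (frame i) (frame i)) (at t within J)" for i
        using d by blast
      from this[of 1] this[of 2] this[of 3] show ?r
        unfolding r h by (simp add: diag_metric_def axis_def)
    next
      assume ?r
      then show "\<forall>u v. ((\<lambda>s. diag_metric (A s) (B s) (C s) u v) has_real_derivative 2 * ?h u v) (at t within J)"
        unfolding r h diag_metric_def by (auto intro!: DERIV_add DERIV_cmult_right)
    qed
    finally show ?thesis .
  qed
  then show ?thesis
    unfolding positive_xcf_on_def xcf_ode_on_def metric_diag_iff by (intro ball_cong refl; blast)
qed

section \<open>Conserved quantities\<close>

lemma convex_time_interval: "convex (time_interval T)"
  unfolding is_interval_convex_1[symmetric] is_interval_1 time_interval_def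
  by auto (meson ereal_less_eq(3) le_less_trans)

lemma zero_derivative_time_interval:
  fixes f :: "real \<Rightarrow> real"
  assumes "\<And>t. t \<in> time_interval T \<Longrightarrow> (f has_real_derivative 0) (at t within time_interval T)"
    and "t \<in> time_interval T"
  shows "f t = f 0"
proof -
  have "0 \<in> time_interval T"
    using assms(2) by (auto simp: time_interval_def intro: le_less_trans[rotated])
  with has_field_derivative_zero_constant[OF convex_time_interval assms(1)] assms(2)
  show ?thesis by metis
qed

text \<open>Relative to the common rate, \<open>A C\<close> has derivative
  \<open>- 2 (A + C)\<^sup>2 A C\<close> and \<open>A - C\<close> has derivative
  \<open>(A + C)\<^sup>2 (A - C)\<close>, which cancel in the first product; the second cancels
  likewise.\<close>

lemma xcf_conserved:
  assumes ode: "xcf_ode_on (time_interval T) A B C" and t: "t \<in> time_interval T"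
  shows "A t * C t * (A t - C t)\<^sup>2 = A 0 * C 0 * (A 0 - C 0)\<^sup>2"
    and "(B t)\<^sup>2 * (A t + C t) ^ 4 / (A t * C t) = (B 0)\<^sup>2 * (A 0 + C 0) ^ 4 / (A 0 * C 0)"
proof -
  let ?J = "time_interval T"
  have "((\<lambda>t. A t * C t * (A t - C t)\<^sup>2) has_real_derivative 0) (at t within ?J)" if "t \<in> ?J" for t
  proof -
    \<comment> \<open>The rate becomes an indeterminate: conservation is a polynomial identity that
      holds for any common rate.\<close>
    define L where "L = xcf_rate (A t) (B t) (C t)"
    show ?thesis
      using ode that unfolding xcf_ode_on_def L_def[symmetric]
      by (auto intro!: derivative_eq_intros) algebra
  qed
  from zero_derivative_time_interval[OF this t]
  show "A t * C t * (A t - C t)\<^sup>2 = A 0 * C 0 * (A 0 - C 0)\<^sup>2" .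
  have "((\<lambda>t. (B t)\<^sup>2 * (A t + C t) ^ 4 / (A t * C t)) has_real_derivative 0) (at t within ?J)" if "t \<in> ?J" for t
  proof -
    define L where "L = xcf_rate (A t) (B t) (C t)"
    have "A t * C t \<noteq> 0" using ode that unfolding xcf_ode_on_def by force
    then show ?thesis
      using ode that unfolding xcf_ode_on_def L_def[symmetric]
      by (auto intro!: derivative_eq_intros) algebra
  qed
  from zero_derivative_time_interval[OF this t]
  show "(B t)\<^sup>2 * (A t + C t) ^ 4 / (A t * C t) = (B 0)\<^sup>2 * (A 0 + C 0) ^ 4 / (A 0 * C 0)" .
qed

lemma diag_solution_iff:
  "diag_solution A0 B0 C0 T A B C \<longleftrightarrow>
    0 < T \<and> A 0 = A0 \<and> B 0 = B0 \<and> C 0 = C0 \<and> xcf_ode_on (time_interval T) A B C"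
  by (simp add: diag_solution_def positive_xcf_on_diag_iff)

text \<open>The explicit functions are checked directly. For uniqueness, the vanishing first
  conserved quantity forces \<open>A' = C'\<close>, the equation for \<open>B'\<close> can then be
  integrated, and the second conserved quantity recovers \<open>A'\<close>.\<close>

lemma symmetric_solution:
  assumes "0 < A0" "0 < B0"
  defines "B \<equiv> \<lambda>t. sqrt (B0\<^sup>2 + 64 * t)"
  shows "maximal_diag_solution A0 B0 A0 \<infinity> (\<lambda>t. A0 * B0 / B t) B (\<lambda>t. A0 * B0 / B t)"
  unfolding maximal_diag_solution_def
proof (intro conjI allI impI ballI)
  have Bpos: "B t > 0" if "t \<ge> 0" for t
    using that assms by (simp add: B_def add_pos_nonneg)
  have "xcf_ode_on (time_interval \<infinity>) (\<lambda>t. A0 * B0 / B t) B (\<lambda>t. A0 * B0 / B t)"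
    unfolding xcf_ode_on_def
  proof (intro ballI)
    fix t assume "t \<in> time_interval \<infinity>"
    then have t: "t \<ge> 0" by (simp add: time_interval_def)
    let ?J = "time_interval \<infinity>"
    let ?A = "A0 * B0 / B t"
    have dB: "(B has_real_derivative 32 / B t) (at t within ?J)"
      using Bpos[OF t] unfolding B_def by (auto intro!: derivative_eq_intros simp: field_simps)
    have dA: "((\<lambda>t. A0 * B0 / B t) has_real_derivative - 32 * ?A / (B t)\<^sup>2) (at t within ?J)"
      by (rule derivative_eq_intros dB refl)+ (use Bpos[OF t] in \<open>simp_all add: power2_eq_square\<close>)
    have pos: "0 < ?A" "0 < B t" using assms Bpos[OF t] by auto
    \<comment> \<open>At \<open>A = C = a\<close>, \<open>B = b\<close> the growth rates collapse to
      \<open>- 32 * a / b\<^sup>2\<close> for \<open>A\<close> and \<open>C\<close> and to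
      \<open>32 / b\<close> for \<open>B\<close>.\<close>
    have rate: "xcf_rate a b a = 8 / (a\<^sup>2 * b\<^sup>2)" if "a > 0" "b > 0" for a b
      using that by (simp add: xcf_rate_def field_simps power2_eq_square)
    have eA: "a * xcf_rate a b a * ((a + a) * (a - 3 * a)) = - 32 * a / b\<^sup>2"
      and eB: "- b * xcf_rate a b a * ((a - 3 * a) * (3 * a - a)) = 32 / b"
      and eC: "- a * xcf_rate a b a * ((a + a) * (3 * a - a)) = - 32 * a / b\<^sup>2" if "a > 0" "b > 0" for a b
      unfolding rate[OF that] using that by (simp_all add: field_simps power2_eq_square)
    show "0 < ?A \<and> 0 < B t \<and> 0 < ?A \<and>
      ((\<lambda>t. A0 * B0 / B t) has_real_derivative ?A * xcf_rate ?A (B t) ?A * ((?A + ?A) * (?A - 3 * ?A))) (at t within ?J) \<and>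
      (B has_real_derivative - B t * xcf_rate ?A (B t) ?A * ((?A - 3 * ?A) * (3 * ?A - ?A))) (at t within ?J) \<and>
      ((\<lambda>t. A0 * B0 / B t) has_real_derivative - ?A * xcf_rate ?A (B t) ?A * ((?A + ?A) * (3 * ?A - ?A))) (at t within ?J)"
      unfolding eA[OF pos] eB[OF pos] eC[OF pos] using pos dA dB by blast
  qed
  then show "diag_solution A0 B0 A0 \<infinity> (\<lambda>t. A0 * B0 / B t) B (\<lambda>t. A0 * B0 / B t)"
    using assms by (simp add: diag_solution_iff B_def)
  fix T' A' B' C'
  assume "diag_solution A0 B0 A0 T' A' B' C'"
  then have init: "A' 0 = A0" "B' 0 = B0" "C' 0 = A0" and ode: "xcf_ode_on (time_interval T') A' B' C'"
    unfolding diag_solution_iff by auto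
  show "T' \<le> \<infinity>" by simp
  let ?J = "time_interval T'"
  have pos: "0 < A' t" "0 < B' t" "0 < C' t" if "t \<in> ?J" for t
    using ode that by (auto simp: xcf_ode_on_def)
  have eq: "C' t = A' t" if "t \<in> ?J" for t
    using xcf_conserved(1)[OF ode that] pos[OF that] by (simp add: init)
  have "((\<lambda>t. (B' t)\<^sup>2 - 64 * t) has_real_derivative 0) (at t within ?J)" if "t \<in> ?J" for t
  proof -
    have "(B' has_real_derivative - B' t * xcf_rate (A' t) (B' t) (C' t) * ((A' t - 3 * C' t) * (3 * A' t - C' t))) (at t within ?J)"
      using ode that unfolding xcf_ode_on_def by blast
    then show ?thesis
      using pos[OF that] unfolding eq[OF that] xcf_rate_def
      by (auto intro!: derivative_eq_intros simp: field_simps power2_eq_square)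
  qed
  from zero_derivative_time_interval[OF this] have B2: "(B' t)\<^sup>2 = B0\<^sup>2 + 64 * t" if "t \<in> ?J" for t
    using that by (fastforce simp: init)
  fix t assume t: "t \<in> ?J"
  show B: "B' t = B t"
    using B2[OF t] pos[OF t] unfolding B_def by (metis less_imp_le real_sqrt_unique)
  \<comment> \<open>For \<open>A = C\<close> the second conserved quantity is
    \<open>16 (A B)\<^sup>2\<close>, so the product \<open>A B\<close> keeps its initial
    value.\<close>
  have "B' t * (B' t * (A' t * A' t)) = B0 * (B0 * (A0 * A0))"
    using xcf_conserved(2)[OF ode t] pos[OF t] assms(1,2)
    by (simp add: eq[OF t] init power4_eq_xxxx power2_eq_square)
  then have "(A' t * B' t)\<^sup>2 = (A0 * B0)\<^sup>2"
    by (simp only: power2_eq_square mult_ac)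
  then have "A' t * B' t = A0 * B0"
    by (rule power2_eq_imp_eq) (use pos[OF t] assms(1,2) in simp_all)
  then have "A' t = A0 * B0 / B' t"
    using pos(2)[OF t] by (simp add: eq_divide_eq)
  then show "A' t = A0 * B0 / B t" "C' t = A0 * B0 / B t"
    by (simp_all only: B eq[OF t])
qed

section \<open>The solution curves\<close>

text \<open>
  Along a solution with \<open>A > C\<close>, the conserved quantities \<open>A C (A - C)\<^sup>2 = a\<^sup>4\<close> and
  \<open>B\<^sup>2 (A + C)\<^sup>4 / (A C) = a\<^sup>2 b\<^sup>2\<close> express \<open>A\<close>, \<open>B\<close>, \<open>C\<close> through \<open>s = (C / A)\<^bsup>1/4\<^esup>\<close>.
\<close>

definition curve_A :: "real \<Rightarrow> real \<Rightarrow> real" where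
  "curve_A a s = a / (s * sqrt (1 - s ^ 4))"

definition curve_B :: "real \<Rightarrow> real \<Rightarrow> real" where
  "curve_B b s = b * s ^ 3 * sqrt (1 - s ^ 4) / (1 + s ^ 4)\<^sup>2"

definition curve_C :: "real \<Rightarrow> real \<Rightarrow> real" where
  "curve_C a s = a * s ^ 3 / sqrt (1 - s ^ 4)"

text \<open>Density of time with respect to the parameter: along a solution,
  \<open>curve_weight s\<close> times the derivative of \<open>s\<close> is the constant
  \<open>- 2 / b\<^sup>2\<close>.\<close>

definition curve_weight :: "real \<Rightarrow> real" where
  "curve_weight s = s ^ 13 / (1 + s ^ 4) ^ 7"

lemma power4_less_1: "0 < s \<Longrightarrow> s < 1 \<Longrightarrow> s ^ 4 < (1::real)"
  by (simp add: power_less_one_iff)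

lemma one_plus_power4_pos: "0 < 1 + s ^ 4" for s :: real
proof -
  have "0 \<le> s ^ 4" by simp
  then show ?thesis by linarith
qed

lemma curve_pos:
  assumes "0 < s" "s < 1" "0 < a" "0 < b"
  shows "0 < curve_A a s" "0 < curve_B b s" "0 < curve_C a s"
proof -
  have "1 + s ^ 4 > 0" using assms by (simp add: add_pos_pos)
  then show "0 < curve_A a s" "0 < curve_B b s" "0 < curve_C a s"
    using assms power4_less_1[of s] by (simp_all add: curve_A_def curve_B_def curve_C_def)
qed

text \<open>On the curve \<open>C = A * s ^ 4\<close>, so quadratic forms in \<open>A\<close> and
  \<open>C\<close> are multiples of \<open>A\<^sup>2\<close>. The product of
  \<open>A\<^sup>2\<close> with the rate is rational in \<open>s\<close> and free of
  \<open>a\<close>.\<close>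

lemma curve_rate:
  assumes s: "0 < s" "s < 1" and ab: "0 < a" "0 < b"
  shows "xcf_rate (curve_A a s) (curve_B b s) (curve_C a s) * (curve_A a s)\<^sup>2
    = 2 * (1 + s ^ 4) ^ 6 / (b\<^sup>2 * s ^ 14 * (1 - s ^ 4))"
proof -
  define w where "w = sqrt (1 - s ^ 4)"
  have w: "w > 0" "w\<^sup>2 = 1 - s ^ 4"
    using power4_less_1[OF s] by (simp_all add: w_def)
  define p where "p = 1 + s ^ 4"
  have p: "p > 0" using s by (simp add: p_def add_pos_pos)
  define A where "A = a / (s * w)"
  have A: "A > 0" using s ab w by (simp add: A_def)
  have C: "a * s ^ 3 / w = A * s ^ 4"
    using s w by (simp add: A_def field_simps eval_nat_numeral)
  have "xcf_rate A (b * s ^ 3 * w / p\<^sup>2) (A * s ^ 4) * A\<^sup>2 = 2 * p ^ 6 / (b\<^sup>2 * s ^ 14 * w\<^sup>2)"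
  proof -
    have "A + A * s ^ 4 = A * p" by (simp add: p_def algebra_simps)
    then show ?thesis
      unfolding xcf_rate_def using A p w s ab by (simp add: field_simps)
  qed
  then show ?thesis
    unfolding curve_A_def curve_B_def curve_C_def w_def[symmetric] p_def[symmetric]
    unfolding C w(2) A_def[symmetric] .
qed

text \<open>Each derivative is written as a multiple of the function itself, the form in which the
  ODE gives it.\<close>

lemma curve_derivative:
  assumes s: "0 < s" "s < 1"
  shows "(curve_A a has_real_derivative - curve_A a s * (1 - 3 * s ^ 4) / (s * (1 - s ^ 4))) (at s)"
    and "(curve_B b has_real_derivative
      curve_B b s * (1 - 3 * s ^ 4) * (3 - s ^ 4) / (s * (1 - s ^ 4) * (1 + s ^ 4))) (at s)"
    and "(curve_C a has_real_derivative curve_C a s * (3 - s ^ 4) / (s * (1 - s ^ 4))) (at s)"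
proof -
  define w where "w s = sqrt (1 - s ^ 4)" for s :: real
  have w: "w s \<noteq> 0" "1 - s ^ 4 = (w s)\<^sup>2"
    using power4_less_1[OF s] by (simp_all add: w_def)
  have cA: "curve_A a = (\<lambda>s. a / (s * w s))"
    by (simp add: curve_A_def fun_eq_iff w_def)
  have cB: "curve_B b = (\<lambda>s. b * s ^ 3 * w s / (1 + s ^ 4)\<^sup>2)"
    by (simp add: curve_B_def fun_eq_iff w_def)
  have cC: "curve_C a = (\<lambda>s. a * s ^ 3 / w s)"
    by (simp add: curve_C_def fun_eq_iff w_def)
  have p: "1 + s ^ 4 \<noteq> 0" using s by (smt (verit) zero_less_power)
  have dw: "(w has_real_derivative - 2 * s ^ 3 / w s) (at s)"
    using power4_less_1[OF s] unfolding w_def by (auto intro!: derivative_eq_intros simp: field_simps)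
  have "((\<lambda>s. a / (s * w s)) has_real_derivative - (a * (w s - 2 * s ^ 4 / w s)) / (s * w s)\<^sup>2) (at s)"
    by (rule derivative_eq_intros dw refl)+ (use w s in \<open>simp_all add: power2_eq_square eval_nat_numeral\<close>)
  moreover have "- (a * (w s - 2 * s ^ 4 / w s)) / (s * w s)\<^sup>2 = - (a / (s * w s)) * (1 - 3 * s ^ 4) / (s * (w s)\<^sup>2)"
  proof -
    have "w s - 2 * s ^ 4 / w s = (1 - 3 * s ^ 4) / w s"
      using w by (simp add: field_simps power2_eq_square)
    then show ?thesis by (simp add: power2_eq_square)
  qed
  ultimately show "(curve_A a has_real_derivative - curve_A a s * (1 - 3 * s ^ 4) / (s * (1 - s ^ 4))) (at s)"
    by (simp only: cA w(2))
  have "((\<lambda>s. a * s ^ 3 / w s) has_real_derivative a * s\<^sup>2 * (3 * w s + 2 * s ^ 4 / w s) / (w s)\<^sup>2) (at s)"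
    by (rule derivative_eq_intros dw refl)+ (use w s in \<open>simp_all add: power2_eq_square eval_nat_numeral algebra_simps\<close>)
  moreover have "a * s\<^sup>2 * (3 * w s + 2 * s ^ 4 / w s) / (w s)\<^sup>2 = a * s ^ 3 / w s * (3 - s ^ 4) / (s * (w s)\<^sup>2)"
  proof -
    have "3 * w s + 2 * s ^ 4 / w s = (3 - s ^ 4) / w s"
      using w by (simp add: field_simps power2_eq_square)
    then show ?thesis using s by (simp add: power2_eq_square eval_nat_numeral)
  qed
  ultimately show "(curve_C a has_real_derivative curve_C a s * (3 - s ^ 4) / (s * (1 - s ^ 4))) (at s)"
    by (simp only: cC w(2))
  define p where "p = 1 + s ^ 4"
  have "((\<lambda>s. b * s ^ 3 * w s / (1 + s ^ 4)\<^sup>2) has_real_derivative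
      (b * s\<^sup>2 * (3 * w s - 2 * s ^ 4 / w s) * p\<^sup>2 - b * s ^ 3 * w s * (8 * s ^ 3 * p)) / (p\<^sup>2)\<^sup>2) (at s)"
    apply (rule derivative_eq_intros dw refl)+
    subgoal using p by simp
    subgoal unfolding p_def[symmetric] by (simp add: power2_eq_square eval_nat_numeral algebra_simps)
    done
  moreover have "(b * s\<^sup>2 * (3 * w s - 2 * s ^ 4 / w s) * p\<^sup>2 - b * s ^ 3 * w s * (8 * s ^ 3 * p)) / (p\<^sup>2)\<^sup>2
      = b * s ^ 3 * w s / p\<^sup>2 * (1 - 3 * s ^ 4) * (3 - s ^ 4) / (s * (w s)\<^sup>2 * p)"
  proof -
    have "3 * w s - 2 * s ^ 4 / w s = (3 - 5 * s ^ 4) / w s"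
      using w by (simp add: field_simps power2_eq_square)
    moreover have "(3 - 5 * s ^ 4) * p - 8 * s ^ 4 * (w s)\<^sup>2 = (1 - 3 * s ^ 4) * (3 - s ^ 4)"
      unfolding w(2)[symmetric] p_def by algebra
    \<comment> \<open>With \<open>x\<close> for \<open>3 - 5 * s ^ 4\<close> and \<open>y\<close>
      for the square root \<open>w s\<close>, only a rational identity in free variables is
      left.\<close>
    moreover have "(b * s\<^sup>2 * (x / y) * p\<^sup>2 - b * s ^ 3 * y * (8 * s ^ 3 * p)) / (p\<^sup>2)\<^sup>2
      = b * s ^ 3 * y / p\<^sup>2 * (x * p - 8 * s ^ 4 * y\<^sup>2) / (s * y\<^sup>2 * p)" if "y \<noteq> 0" for x y
      using that s p unfolding p_def[symmetric] by (simp add: divide_simps) algebra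
    ultimately show ?thesis using w(1) by (simp add: mult.assoc)
  qed
  ultimately show "(curve_B b has_real_derivative
      curve_B b s * (1 - 3 * s ^ 4) * (3 - s ^ 4) / (s * (1 - s ^ 4) * (1 + s ^ 4))) (at s)"
    by (simp only: cB w(2) p_def)
qed

lemma curve_C_eq: "0 < s \<Longrightarrow> curve_C a s = curve_A a s * s ^ 4"
  by (simp add: curve_A_def curve_C_def eval_nat_numeral)

text \<open>Substituting \<open>C = A * s ^ 4\<close> turns the first conserved quantity into
  \<open>(A * s * w) ^ 4\<close> with \<open>w = sqrt (1 - s ^ 4)\<close>, which determines
  \<open>A\<close>; the second then determines \<open>B\<close>. Positivity selects the
  roots.\<close>

lemma curve_of_metric:
  assumes "0 < C" "C < A" "0 < B" "0 < a" "0 < b" "0 < s"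
    and s: "s ^ 4 = C / A"
    and a: "A * C * (A - C)\<^sup>2 = a ^ 4" and b: "B\<^sup>2 * (A + C) ^ 4 / (A * C) = a\<^sup>2 * b\<^sup>2"
  shows "s < 1" "A = curve_A a s" "B = curve_B b s" "C = curve_C a s"
proof -
  have "s ^ 4 < 1" using assms by simp
  then show s1: "s < 1"
    using \<open>0 < s\<close> by (simp add: power_less_one_iff)
  define w where "w = sqrt (1 - s ^ 4)"
  have w: "w > 0" "w\<^sup>2 = 1 - s ^ 4"
    using \<open>s ^ 4 < 1\<close> by (simp_all add: w_def)
  have C: "C = A * s ^ 4" using assms by simp
  have A0: "A > 0" using assms by simp
  have "(A * s * w) ^ 4 = A ^ 4 * s ^ 4 * (w\<^sup>2)\<^sup>2"
    by (simp add: power_mult_distrib)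
  also have "\<dots> = a ^ 4"
    unfolding w(2) a[symmetric] C by (simp add: power2_eq_square power4_eq_xxxx algebra_simps)
  finally have "A * s * w = a"
    by (rule power_eq_imp_eq_base) (use A0 w(1) assms(4,6) in simp_all)
  then have A: "A = a / (s * w)"
    using w(1) assms(6) by (auto simp: eq_divide_eq mult.assoc)
  then show "A = curve_A a s" by (simp add: curve_A_def w_def)
  with C curve_C_eq[of s a] assms(6) show "C = curve_C a s" by simp
  have "A + C = A * (1 + s ^ 4)" by (simp add: C algebra_simps)
  then have "B\<^sup>2 * (A * (1 + s ^ 4)) ^ 4 = a\<^sup>2 * b\<^sup>2 * (A * (A * s ^ 4))"
    using b A0 assms(6) unfolding C by (simp add: divide_eq_eq)
  moreover have "B\<^sup>2 * (A * (1 + s ^ 4)) ^ 4 = A\<^sup>2 * (B\<^sup>2 * A\<^sup>2 * (1 + s ^ 4) ^ 4)"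
    by (simp add: power_mult_distrib eval_nat_numeral)
  moreover have "a\<^sup>2 * b\<^sup>2 * (A * (A * s ^ 4)) = A\<^sup>2 * (a\<^sup>2 * b\<^sup>2 * s ^ 4)"
    by (simp add: power2_eq_square)
  ultimately have "B\<^sup>2 * A\<^sup>2 * (1 + s ^ 4) ^ 4 = a\<^sup>2 * b\<^sup>2 * s ^ 4"
    using A0 by simp
  then have "B\<^sup>2 * A\<^sup>2 * (1 + s ^ 4) ^ 4 * (s * w)\<^sup>2 = a\<^sup>2 * b\<^sup>2 * s ^ 4 * (s * w)\<^sup>2"
    by simp
  moreover have "A\<^sup>2 * (s * w)\<^sup>2 = a\<^sup>2"
    using A w(1) assms(6) by (simp flip: power_mult_distrib)
  ultimately have "a\<^sup>2 * (B * (1 + s ^ 4)\<^sup>2)\<^sup>2 = a\<^sup>2 * (b * s ^ 3 * w)\<^sup>2"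
    by algebra
  then have "(B * (1 + s ^ 4)\<^sup>2)\<^sup>2 = (b * s ^ 3 * w)\<^sup>2"
    using assms(4) by simp
  then have "B * (1 + s ^ 4)\<^sup>2 = b * s ^ 3 * w"
    by (rule power2_eq_imp_eq) (use w(1) assms(3,5,6) in simp_all)
  moreover have "1 + s ^ 4 > 0" using assms(6) by (simp add: add_pos_pos)
  ultimately show "B = curve_B b s"
    by (simp add: curve_B_def w_def[symmetric] eq_divide_eq)
qed

section \<open>Motion along a solution curve\<close>

text \<open>Normalized to vanish at the singular end \<open>s = 0\<close>; along a solution it is
  \<open>2 / b\<^sup>2\<close> times the time left until blow-up.\<close>

definition curve_time :: "real \<Rightarrow> real" where
  "curve_time s = integral {0..s} curve_weight"

lemma continuous_on_curve_weight: "continuous_on S curve_weight"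
proof -
  have "1 + s ^ 4 \<noteq> 0" for s :: real
    using one_plus_power4_pos[of s] by simp
  then show ?thesis
    unfolding curve_weight_def[abs_def] by (intro continuous_intros) auto
qed

lemma curve_weight_pos: "0 < s \<Longrightarrow> 0 < curve_weight s"
  by (simp add: curve_weight_def add_pos_pos)

lemma curve_time_0 [simp]: "curve_time 0 = 0"
  by (simp add: curve_time_def)

lemma curve_time_derivative:
  assumes "0 < s"
  shows "(curve_time has_real_derivative curve_weight s) (at s)"
proof -
  \<comment> \<open>The right end \<open>s + 1\<close> makes \<open>s\<close> an interior point, so
    the derivative is two-sided.\<close>
  have "(curve_time has_real_derivative curve_weight s) (at s within {0..s + 1})"
    unfolding curve_time_def[abs_def]
    using assms by (intro integral_has_real_derivative continuous_on_curve_weight) auto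
  then show ?thesis
    using assms by (simp add: at_within_Icc_at)
qed

lemma continuous_on_curve_time: "continuous_on {0..b} curve_time"
  unfolding curve_time_def[abs_def]
  by (intro indefinite_integral_continuous_1 integrable_continuous_real continuous_on_curve_weight)

lemma curve_time_strict_mono:
  assumes "0 \<le> x" "x < y"
  shows "curve_time x < curve_time y"
proof (rule DERIV_pos_imp_increasing_open[OF assms(2)])
  show "\<exists>d. (curve_time has_real_derivative d) (at s) \<and> 0 < d" if "x < s" "s < y" for s
    using that assms curve_time_derivative[of s] curve_weight_pos[of s] by auto
  show "continuous_on {x..y} curve_time"
    by (rule continuous_on_subset[OF continuous_on_curve_time[of y]]) (use assms in auto)
qed

text \<open>By l'Hopital's rule: the quotient of the derivatives is
  \<open>14 * (1 + s ^ 4) ^ 7\<close>.\<close>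

lemma curve_time_asymp: "((\<lambda>s. s ^ 14 / curve_time s) \<longlongrightarrow> 14) (at_right 0)"
proof (rule lhopital_right_0)
  show "((\<lambda>s::real. s ^ 14) \<longlongrightarrow> 0) (at_right 0)"
    by (auto intro!: tendsto_eq_intros)
  have "(curve_time \<longlongrightarrow> curve_time 0) (at 0 within {0..1})"
    using continuous_on_curve_time[of 1] by (simp add: continuous_on_def del: curve_time_0)
  then show "(curve_time \<longlongrightarrow> 0) (at_right 0)"
    by (simp add: at_within_Icc_at_right)
  have pos: "\<forall>\<^sub>F s::real in at_right 0. 0 < s"
    by (simp add: eventually_at_right_less)
  show "\<forall>\<^sub>F s in at_right 0. curve_time s \<noteq> 0"
    using pos by eventually_elim (use curve_time_strict_mono[of 0] in fastforce)
  show "\<forall>\<^sub>F s in at_right 0. curve_weight s \<noteq> 0"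
    using pos by eventually_elim (use curve_weight_pos in fastforce)
  show "\<forall>\<^sub>F s in at_right 0. ((\<lambda>s::real. s ^ 14) has_real_derivative 14 * s ^ 13) (at s)"
    by (intro always_eventually allI) (auto intro!: derivative_eq_intros)
  show "\<forall>\<^sub>F s in at_right 0. (curve_time has_real_derivative curve_weight s) (at s)"
    using pos by eventually_elim (rule curve_time_derivative)
  have "((\<lambda>s::real. 14 * (1 + s ^ 4) ^ 7) \<longlongrightarrow> 14) (at_right 0)"
    by (auto intro!: tendsto_eq_intros)
  moreover have "\<forall>\<^sub>F s in at_right 0. 14 * (1 + s ^ 4) ^ 7 = 14 * s ^ 13 / curve_weight s"
    using pos by eventually_elim (simp add: curve_weight_def)
  ultimately show "((\<lambda>s. 14 * s ^ 13 / curve_weight s) \<longlongrightarrow> 14) (at_right 0)"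
    by (rule Lim_transform_eventually)
qed

text \<open>The first three identities say that the ODE moves along the curve with parameter
  velocity \<open>- v\<close>, and serve existence. The fourth, for the fourth root of
  \<open>C / A\<close>, yields that velocity for a given solution, and serves uniqueness.\<close>

lemma curve_xcf_rates:
  assumes s: "0 < s" "s < 1" and ab: "0 < a" "0 < b"
  defines "A \<equiv> curve_A a s" and "B \<equiv> curve_B b s" and "C \<equiv> curve_C a s"
    and "v \<equiv> 2 / b\<^sup>2 / curve_weight s"
  shows "A * xcf_rate A B C * ((A + C) * (A - 3 * C)) = - A * (1 - 3 * s ^ 4) / (s * (1 - s ^ 4)) * - v"
    and "- B * xcf_rate A B C * ((A - 3 * C) * (3 * A - C))
      = B * (1 - 3 * s ^ 4) * (3 - s ^ 4) / (s * (1 - s ^ 4) * (1 + s ^ 4)) * - v"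
    and "- C * xcf_rate A B C * ((A + C) * (3 * A - C)) = C * (3 - s ^ 4) / (s * (1 - s ^ 4)) * - v"
    and "s * xcf_rate A B C * ((A + C) * (A - C)) = v"
proof -
  define L where "L = xcf_rate A B C"
  define p where "p = 1 + s ^ 4"
  define m where "m = 1 - s ^ 4"
  have nz: "p \<noteq> 0" "m \<noteq> 0" "s \<noteq> 0" "b \<noteq> 0"
    using s ab power4_less_1[OF s] one_plus_power4_pos[of s] by (auto simp: p_def m_def)
  have C: "C = A * s ^ 4" unfolding A_def C_def by (rule curve_C_eq[OF s(1)])
  have L: "L * A\<^sup>2 = 2 * p ^ 6 / (b\<^sup>2 * s ^ 14 * m)"
    unfolding L_def p_def m_def A_def B_def C_def by (rule curve_rate[OF s ab])
  have v: "v = 2 * p ^ 7 / (b\<^sup>2 * s ^ 13)"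
    by (simp add: v_def curve_weight_def p_def)
  have "A * L * ((A + C) * (A - 3 * C)) = A * (L * A\<^sup>2) * (p * (1 - 3 * s ^ 4))"
    unfolding C p_def by algebra
  also have "\<dots> = - A * (1 - 3 * s ^ 4) / (s * m) * - v"
    unfolding L v using nz by (simp add: divide_simps) algebra
  finally show "A * xcf_rate A B C * ((A + C) * (A - 3 * C)) = - A * (1 - 3 * s ^ 4) / (s * (1 - s ^ 4)) * - v"
    unfolding L_def m_def .
  have "- B * L * ((A - 3 * C) * (3 * A - C)) = - B * (L * A\<^sup>2) * ((1 - 3 * s ^ 4) * (3 - s ^ 4))"
    unfolding C by algebra
  also have "\<dots> = B * (1 - 3 * s ^ 4) * (3 - s ^ 4) / (s * m * p) * - v"
    unfolding L v using nz by (simp add: divide_simps) algebra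
  finally show "- B * xcf_rate A B C * ((A - 3 * C) * (3 * A - C))
      = B * (1 - 3 * s ^ 4) * (3 - s ^ 4) / (s * (1 - s ^ 4) * (1 + s ^ 4)) * - v"
    unfolding L_def m_def p_def .
  have "- C * L * ((A + C) * (3 * A - C)) = - C * (L * A\<^sup>2) * (p * (3 - s ^ 4))"
    unfolding C p_def by algebra
  also have "\<dots> = C * (3 - s ^ 4) / (s * m) * - v"
    unfolding L v using nz by (simp add: divide_simps) algebra
  finally show "- C * xcf_rate A B C * ((A + C) * (3 * A - C)) = C * (3 - s ^ 4) / (s * (1 - s ^ 4)) * - v"
    unfolding L_def m_def .
  have "s * L * ((A + C) * (A - C)) = s * (L * A\<^sup>2) * (p * m)"
    unfolding C p_def m_def by algebra
  also have "\<dots> = v"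
    unfolding L v using nz by (simp add: divide_simps) algebra
  finally show "s * xcf_rate A B C * ((A + C) * (A - C)) = v"
    unfolding L_def .
qed

lemma xcf_ode_on_curve:
  assumes "0 < a" "0 < b"
    and s: "\<And>t. t \<in> J \<Longrightarrow> 0 < s t \<and> s t < 1
      \<and> (s has_real_derivative - (2 / b\<^sup>2 / curve_weight (s t))) (at t within J)"
  shows "xcf_ode_on J (\<lambda>t. curve_A a (s t)) (\<lambda>t. curve_B b (s t)) (\<lambda>t. curve_C a (s t))"
  unfolding xcf_ode_on_def
proof (intro ballI)
  fix t assume "t \<in> J"
  then have st: "0 < s t" "s t < 1"
    and ds: "(s has_real_derivative - (2 / b\<^sup>2 / curve_weight (s t))) (at t within J)"
    using s by auto
  note r = curve_xcf_rates[OF st assms(1,2)]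
  note d = curve_derivative[OF st]
  show "0 < curve_A a (s t) \<and> 0 < curve_B b (s t) \<and> 0 < curve_C a (s t)
    \<and> ((\<lambda>t. curve_A a (s t)) has_real_derivative curve_A a (s t) * xcf_rate (curve_A a (s t)) (curve_B b (s t)) (curve_C a (s t))
        * ((curve_A a (s t) + curve_C a (s t)) * (curve_A a (s t) - 3 * curve_C a (s t)))) (at t within J)
    \<and> ((\<lambda>t. curve_B b (s t)) has_real_derivative - curve_B b (s t) * xcf_rate (curve_A a (s t)) (curve_B b (s t)) (curve_C a (s t))
        * ((curve_A a (s t) - 3 * curve_C a (s t)) * (3 * curve_A a (s t) - curve_C a (s t)))) (at t within J)
    \<and> ((\<lambda>t. curve_C a (s t)) has_real_derivative - curve_C a (s t) * xcf_rate (curve_A a (s t)) (curve_B b (s t)) (curve_C a (s t))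
        * ((curve_A a (s t) + curve_C a (s t)) * (3 * curve_A a (s t) - curve_C a (s t)))) (at t within J)"
    unfolding r(1-3)
    using curve_pos[OF st assms(1,2)] DERIV_chain2[OF d(1) ds] DERIV_chain2[OF d(2) ds] DERIV_chain2[OF d(3) ds]
    by blast
qed

text \<open>The conserved quantities confine a solution to the curve, and separation of variables
  makes \<open>curve_time\<close> affine in time. This leaves no freedom beyond the initial
  data.\<close>

lemma xcf_solution_on_curve:
  assumes ode: "xcf_ode_on (time_interval T) A B C" and AC: "A 0 > C 0"
    and ab: "0 < a" "0 < b" "A 0 * C 0 * (A 0 - C 0)\<^sup>2 = a ^ 4"
      "(B 0)\<^sup>2 * (A 0 + C 0) ^ 4 / (A 0 * C 0) = a\<^sup>2 * b\<^sup>2"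
    and t: "t \<in> time_interval T"
  defines "s \<equiv> \<lambda>t. root 4 (C t / A t)"
  shows "0 < s t" "s t < 1" "A t = curve_A a (s t)" "B t = curve_B b (s t)" "C t = curve_C a (s t)"
    and "curve_time (s t) = curve_time (s 0) - 2 / b\<^sup>2 * t"
proof -
  let ?J = "time_interval T"
  have pos: "0 < A t" "0 < B t" "0 < C t" if "t \<in> ?J" for t
    using ode that by (auto simp: xcf_ode_on_def)
  \<comment> \<open>If \<open>A > C\<close> failed, \<open>A = C\<close> would hold at some earlier
    or equal time, and there the first conserved quantity would vanish, although it equals
    \<open>a ^ 4 > 0\<close>.\<close>
  have gt: "C t < A t" if t: "t \<in> ?J" for t
  proof (rule ccontr)
    assume "\<not> C t < A t"
    have sub: "{0..t} \<subseteq> ?J"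
      using t by (auto simp: time_interval_def) (meson ereal_less_eq(3) le_less_trans)
    have "continuous_on ?J A" "continuous_on ?J C"
      using ode unfolding xcf_ode_on_def by (auto intro!: DERIV_continuous_on)
    then have "continuous_on {0..t} (\<lambda>t. A t - C t)"
      by (intro continuous_on_diff) (auto intro: continuous_on_subset[OF _ sub])
    then obtain u where "0 \<le> u" "u \<le> t" "A u - C u = 0"
      using IVT2'[of "\<lambda>t. A t - C t" t 0 0] \<open>\<not> C t < A t\<close> AC t by (auto simp: time_interval_def)
    moreover from this have "u \<in> ?J" using sub by auto
    ultimately have "a ^ 4 = 0"
      using xcf_conserved(1)[OF ode] ab(3) by fastforce
    then show False using ab by simp
  qed
  have sp: "0 < s t" "(s t) ^ 4 = C t / A t" if "t \<in> ?J" for t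
    using pos[OF that] by (simp_all add: s_def)
  have curve: "s t < 1" "A t = curve_A a (s t)" "B t = curve_B b (s t)" "C t = curve_C a (s t)" if t: "t \<in> ?J" for t
    using curve_of_metric[OF pos(3)[OF t] gt[OF t] pos(2)[OF t] ab(1,2) sp[OF t]]
      xcf_conserved[OF ode t] ab(3,4) by simp_all
  show "0 < s t" "s t < 1" "A t = curve_A a (s t)" "B t = curve_B b (s t)" "C t = curve_C a (s t)"
    using sp(1)[OF t] curve[OF t] by simp_all
  have "((\<lambda>t. curve_time (s t) + 2 / b\<^sup>2 * t) has_real_derivative 0) (at t within ?J)" if t: "t \<in> ?J" for t
  proof -
    define L where "L = xcf_rate (A t) (B t) (C t)"
    have "(A has_real_derivative A t * L * ((A t + C t) * (A t - 3 * C t))) (at t within ?J)"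
      "(C has_real_derivative - C t * L * ((A t + C t) * (3 * A t - C t))) (at t within ?J)"
      using ode t unfolding xcf_ode_on_def L_def by blast+
    from DERIV_divide[OF this(2,1)]
    have "((\<lambda>t. C t / A t) has_real_derivative - 4 * (C t / A t) * L * ((A t + C t) * (A t - C t))) (at t within ?J)"
    proof (rule DERIV_cong)
      have "- C t * L * ((A t + C t) * (3 * A t - C t)) * A t - C t * (A t * L * ((A t + C t) * (A t - 3 * C t)))
          = - 4 * C t * L * ((A t + C t) * (A t - C t)) * A t"
        by algebra
      then show "(- C t * L * ((A t + C t) * (3 * A t - C t)) * A t - C t * (A t * L * ((A t + C t) * (A t - 3 * C t)))) / (A t * A t)
          = - 4 * (C t / A t) * L * ((A t + C t) * (A t - C t))"
        by simp
    qed (use pos[OF t] in simp)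
    from DERIV_chain2[OF DERIV_real_root this, of 4] 
    have "(s has_real_derivative inverse (4 * s t ^ 3) * (- 4 * s t ^ 4 * L * ((A t + C t) * (A t - C t)))) (at t within ?J)"
      using pos[OF t] unfolding sp(2)[OF t] by (simp add: s_def)
    moreover have "inverse (4 * s t ^ 3) * (- 4 * s t ^ 4 * L * ((A t + C t) * (A t - C t)))
        = - (s t * L * ((A t + C t) * (A t - C t)))"
      using sp(1)[OF t] by (simp add: field_simps eval_nat_numeral)
    moreover have "s t * L * ((A t + C t) * (A t - C t)) = 2 / b\<^sup>2 / curve_weight (s t)"
      using curve_xcf_rates(4)[OF sp(1)[OF t] curve(1)[OF t] ab(1,2)]
      unfolding L_def curve(2-4)[OF t, symmetric] .
    ultimately have "(s has_real_derivative - (2 / b\<^sup>2 / curve_weight (s t))) (at t within ?J)"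
      by (simp only:)
    from DERIV_chain2[OF curve_time_derivative[OF sp(1)[OF t]] this]
    have "((\<lambda>t. curve_time (s t)) has_real_derivative - (2 / b\<^sup>2)) (at t within ?J)"
      using curve_weight_pos[OF sp(1)[OF t]] by simp
    from DERIV_add[OF this DERIV_cmult[OF DERIV_ident, of "2 / b\<^sup>2"]] show ?thesis by simp
  qed
  from zero_derivative_time_interval[OF this t]
  show "curve_time (s t) = curve_time (s 0) - 2 / b\<^sup>2 * t" by simp
qed

section \<open>Blow-up in finite time\<close>

text \<open>The parameter is obtained by inverting the strictly increasing
  \<open>curve_time\<close>; the inverse function rule gives its derivative.\<close>

lemma curve_time_inverse:
  assumes "0 < c" "0 < s0" "s0 < 1"
  defines "Tb \<equiv> curve_time s0 / c"
  obtains s where "s 0 = s0"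
    and "\<And>t. 0 \<le> t \<Longrightarrow> t < Tb \<Longrightarrow> 0 < s t \<and> s t < 1 \<and> curve_time (s t) = c * (Tb - t)
      \<and> (s has_real_derivative - (c / curve_weight (s t))) (at t)"
proof -
  \<comment> \<open>The time at which the parameter would be 1. It is negative, so 0 is an interior
    time and the derivative there is two-sided.\<close>
  define T0 where "T0 = Tb - curve_time 1 / c"
  have T0: "T0 < 0"
    using assms curve_time_strict_mono[of s0 1] by (simp add: T0_def field_simps)
  have "\<exists>x. 0 < x \<and> x < 1 \<and> curve_time x = c * (Tb - t)" if t: "T0 < t" "t < Tb" for t
  proof -
    have y: "0 < c * (Tb - t)" "c * (Tb - t) < curve_time 1"
      using t assms(1) by (auto simp: T0_def field_simps)
    then obtain x where x: "0 \<le> x" "x \<le> 1" "curve_time x = c * (Tb - t)"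
      using IVT'[of curve_time 0 "c * (Tb - t)" 1] continuous_on_curve_time[of 1] by auto
    moreover have "x \<noteq> 0" "x \<noteq> 1" using x y by auto
    ultimately show ?thesis by (intro exI[of _ x]) auto
  qed
  then obtain s where s: "\<And>t. T0 < t \<Longrightarrow> t < Tb \<Longrightarrow> 0 < s t \<and> s t < 1 \<and> curve_time (s t) = c * (Tb - t)"
    by metis
  have inj: "x = y" if "0 < x" "0 < y" "curve_time x = curve_time y" for x y
    using that curve_time_strict_mono[of x y] curve_time_strict_mono[of y x] by (cases x y rule: linorder_cases) auto
  \<comment> \<open>Time as a function of the parameter, the inverse of \<open>s\<close>.\<close>
  define f where "f x = Tb - curve_time x / c" for x
  have f: "T0 < f x" "f x < Tb" if "0 < x" "x < 1" for x
    using that assms(1) curve_time_strict_mono[of x 1] curve_time_strict_mono[of 0 x]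
    by (auto simp: f_def T0_def divide_strict_right_mono)
  have df: "(f has_real_derivative - (curve_weight x / c)) (at x)" if "0 < x" for x
    unfolding f_def[abs_def] using curve_time_derivative[OF that] assms(1)
    by (auto intro!: derivative_eq_intros)
  have fs: "f (s t) = t" if "T0 < t" "t < Tb" for t
    using s[OF that] assms(1) by (simp add: f_def)
  have sf: "s (f x) = x" if "0 < x" "x < 1" for x
  proof (rule inj)
    show "curve_time (s (f x)) = curve_time x"
      using s[OF f[OF that]] assms(1) by (simp add: f_def)
  qed (use s[OF f[OF that]] that in simp_all)
  have ds: "(s has_real_derivative - (c / curve_weight (s t))) (at t)" if t: "T0 < t" "t < Tb" for t
  proof -
    note st = s[OF t]
    \<comment> \<open>The inverse function rule requires continuity of \<open>s\<close>, which holds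
      because \<open>f\<close> is continuous with left inverse \<open>s\<close> on a compact
      neighbourhood of \<open>s t\<close> inside the open unit interval.\<close>
    have "isCont s (f (s t))"
    proof (rule isCont_inverse_function2[where f = f and x = "s t"])
      show "s t / 2 < s t" "s t < (s t + 1) / 2" using st by auto
      fix z assume "s t / 2 \<le> z" "z \<le> (s t + 1) / 2"
      then have z: "0 < z" "z < 1" using st by auto
      show "s (f z) = z" by (rule sf[OF z])
      show "isCont f z" by (rule DERIV_isCont[OF df[OF z(1)]])
    qed
    then have cont: "isCont s t" using fs[OF t] by simp
    have "(s has_real_derivative inverse (- (curve_weight (s t) / c))) (at t)"
    proof (rule DERIV_inverse_function[OF _ _ t _ cont])
      show "(f has_real_derivative - (curve_weight (s t) / c)) (at (s t))"
        using st by (intro df) simp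
      show "- (curve_weight (s t) / c) \<noteq> 0"
        using st curve_weight_pos[of "s t"] assms(1) by simp
    qed (rule fs)
    then show ?thesis by simp
  qed
  have "Tb > 0"
    using assms curve_time_strict_mono[of 0 s0] by (simp add: Tb_def)
  then have "0 < s 0" "curve_time (s 0) = curve_time s0"
    using s[OF T0] assms(1) by (simp_all add: Tb_def)
  from inj[OF this(1) assms(2) this(2)] have "s 0 = s0" .
  then show ?thesis
  proof (rule that)
    fix t assume "0 \<le> t" "t < Tb"
    then have "T0 < t" "t < Tb" using T0 by auto
    from s[OF this] ds[OF this] show "0 < s t \<and> s t < 1 \<and> curve_time (s t) = c * (Tb - t)
      \<and> (s has_real_derivative - (c / curve_weight (s t))) (at t)" by blast
  qed
qed

section \<open>Asymptotics at the blow-up time\<close>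

lemma curve_parameter_asymp:
  assumes c: "0 < c" and Tb: "0 < Tb"
    and s: "\<And>t. 0 \<le> t \<Longrightarrow> t < Tb \<Longrightarrow> 0 < s t \<and> s t < 1 \<and> curve_time (s t) = c * (Tb - t)"
  shows "(s \<longlongrightarrow> 0) (at_left Tb)"
    and "((\<lambda>t. s t / (Tb - t) powr (1 / 14)) \<longlongrightarrow> (14 * c) powr (1 / 14)) (at_left Tb)"
proof -
  have near: "\<forall>\<^sub>F t in at_left Tb. max 0 u < t \<and> t < Tb" if "u < Tb" for u
    by (rule eventually_at_leftI[of "max 0 u"]) (use Tb that in auto)
  show lim: "(s \<longlongrightarrow> 0) (at_left Tb)"
  proof (rule order_tendstoI)
    fix x :: real assume "x < 0"
    show "\<forall>\<^sub>F t in at_left Tb. x < s t"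
      using near[OF Tb]
    proof eventually_elim
      case (elim t)
      then show ?case using s[of t] \<open>x < 0\<close> by simp
    qed
  next
    fix x :: real assume "0 < x"
    then have "curve_time x > 0" using curve_time_strict_mono[of 0 x] by simp
    \<comment> \<open>From this time on, \<open>c * (Tb - t)\<close> is below
      \<open>curve_time x\<close>, so monotonicity keeps the parameter below
      \<open>x\<close>.\<close>
    then have "Tb - curve_time x / c < Tb" using c by simp
    from near[OF this] show "\<forall>\<^sub>F t in at_left Tb. s t < x"
    proof eventually_elim
      case (elim t)
      then have "curve_time (s t) < curve_time x"
        using s[of t] c by (simp add: field_simps)
      then show ?case
        using curve_time_strict_mono[of x "s t"] \<open>0 < x\<close> by (cases "s t" x rule: linorder_cases) auto
    qed
  qed
  have "\<forall>\<^sub>F t in at_left Tb. s t \<in> {0<..} \<and> s t \<noteq> 0"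
    using near[OF Tb]
  proof eventually_elim
    case (elim t)
    then show ?case using s[of t] by simp
  qed
  with lim have "filterlim s (at_right 0) (at_left Tb)"
    by (simp add: filterlim_at)
  from filterlim_compose[OF curve_time_asymp this]
  have "((\<lambda>t. s t ^ 14 / curve_time (s t)) \<longlongrightarrow> 14) (at_left Tb)" .
  \<comment> \<open>Since \<open>curve_time (s t) = c * (Tb - t)\<close>, the limit says that
    \<open>s t ^ 14 / (Tb - t)\<close> tends to \<open>14 * c\<close>; the fourteenth root is
    taken.\<close>
  from tendsto_powr[OF tendsto_mult_right[OF this, of c] tendsto_const, of "1 / 14"] c
  have "((\<lambda>t. (c * (s t ^ 14 / curve_time (s t))) powr (1 / 14)) \<longlongrightarrow> (c * 14) powr (1 / 14)) (at_left Tb)"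
    by (simp add: mult.commute)
  moreover have "\<forall>\<^sub>F t in at_left Tb. (c * (s t ^ 14 / curve_time (s t))) powr (1 / 14) = s t / (Tb - t) powr (1 / 14)"
    using near[OF Tb]
  proof eventually_elim
    case (elim t)
    then have st: "0 < s t" "curve_time (s t) = c * (Tb - t)" using s[of t] by auto
    have "(s t ^ 14) powr (1 / 14) = s t"
      using st(1) powr_powr[of "s t" 14 "1 / 14"] by simp
    then show ?case
      using st c elim by (simp add: powr_divide)
  qed
  ultimately show "((\<lambda>t. s t / (Tb - t) powr (1 / 14)) \<longlongrightarrow> (14 * c) powr (1 / 14)) (at_left Tb)"
    unfolding mult.commute[of 14 c] by (rule Lim_transform_eventually)
qed

text \<open>The factors \<open>sqrt (1 - s ^ 4)\<close> and \<open>1 + s ^ 4\<close> tend to 1,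
  leaving \<open>a / s\<close>, \<open>b * s ^ 3\<close>, \<open>a * s ^ 3\<close>, where
  \<open>s\<close> is asymptotic to \<open>k\<close> times the fourteenth root of
  \<open>Tb - t\<close>.\<close>

lemma curve_asymp:
  assumes "0 < a" "0 < b" "0 < k" and lim0: "(s \<longlongrightarrow> 0) (at_left Tb)"
    and lim: "((\<lambda>t. s t / (Tb - t) powr (1 / 14)) \<longlongrightarrow> k) (at_left Tb)"
  shows "(\<lambda>t. curve_A a (s t)) \<sim>[at_left Tb] (\<lambda>t. a / k * (Tb - t) powr (- 1 / 14))"
    and "(\<lambda>t. curve_B b (s t)) \<sim>[at_left Tb] (\<lambda>t. b * k ^ 3 * (Tb - t) powr (3 / 14))"
    and "(\<lambda>t. curve_C a (s t)) \<sim>[at_left Tb] (\<lambda>t. a * k ^ 3 * (Tb - t) powr (3 / 14))"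
proof -
  define q where "q t = (Tb - t) powr (1 / 14)" for t
  have near: "\<forall>\<^sub>F t in at_left Tb. t < Tb"
    by (auto intro: eventually_at_leftI[of "Tb - 1"])
  have q1: "(Tb - t) powr (- 1 / 14) = 1 / q t" for t
    by (simp add: q_def powr_minus_divide)
  have q3: "(Tb - t) powr (3 / 14) = q t ^ 3" if "t < Tb" for t
    using that by (simp add: q_def powr_powr flip: powr_realpow)
  have l: "((\<lambda>t. s t / q t) \<longlongrightarrow> k) (at_left Tb)"
    using lim by (simp add: q_def)
  have w: "((\<lambda>t. sqrt (1 - s t ^ 4)) \<longlongrightarrow> 1) (at_left Tb)"
    and p: "((\<lambda>t. (1 + s t ^ 4)\<^sup>2) \<longlongrightarrow> 1) (at_left Tb)"
    using lim0 by (auto intro!: tendsto_eq_intros)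
  have l3: "((\<lambda>t. (s t / q t) ^ 3 / k ^ 3) \<longlongrightarrow> 1) (at_left Tb)"
    using \<open>0 < k\<close> tendsto_divide[OF tendsto_power[OF l, of 3] tendsto_const, of "k ^ 3"] by simp
  have "((\<lambda>t. k / ((s t / q t) * sqrt (1 - s t ^ 4))) \<longlongrightarrow> 1) (at_left Tb)"
    using \<open>0 < k\<close> tendsto_divide[OF tendsto_const tendsto_mult[OF l w], of k] by simp
  then show "(\<lambda>t. curve_A a (s t)) \<sim>[at_left Tb] (\<lambda>t. a / k * (Tb - t) powr (- 1 / 14))"
    using \<open>0 < a\<close> unfolding q1 by (intro asymp_equivI') (simp add: curve_A_def mult_ac)
  have "((\<lambda>t. (s t / q t) ^ 3 / k ^ 3 * sqrt (1 - s t ^ 4) / (1 + s t ^ 4)\<^sup>2) \<longlongrightarrow> 1) (at_left Tb)"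
    using \<open>0 < k\<close> tendsto_divide[OF tendsto_mult[OF l3 w] p] by simp
  then have "((\<lambda>t. curve_B b (s t) / (b * k ^ 3 * (Tb - t) powr (3 / 14))) \<longlongrightarrow> 1) (at_left Tb)"
    by (rule Lim_transform_eventually)
      (use near \<open>0 < b\<close> in \<open>auto elim!: eventually_mono simp: curve_B_def q3 power_divide\<close>)
  then show "(\<lambda>t. curve_B b (s t)) \<sim>[at_left Tb] (\<lambda>t. b * k ^ 3 * (Tb - t) powr (3 / 14))"
    by (rule asymp_equivI')
  have "((\<lambda>t. (s t / q t) ^ 3 / k ^ 3 / sqrt (1 - s t ^ 4)) \<longlongrightarrow> 1) (at_left Tb)"
    using \<open>0 < k\<close> tendsto_divide[OF l3 w] by simp
  then have "((\<lambda>t. curve_C a (s t) / (a * k ^ 3 * (Tb - t) powr (3 / 14))) \<longlongrightarrow> 1) (at_left Tb)"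
    by (rule Lim_transform_eventually)
      (use near \<open>0 < a\<close> in \<open>auto elim!: eventually_mono simp: curve_C_def q3 power_divide\<close>)
  then show "(\<lambda>t. curve_C a (s t)) \<sim>[at_left Tb] (\<lambda>t. a * k ^ 3 * (Tb - t) powr (3 / 14))"
    by (rule asymp_equivI')
qed

text \<open>Any competing solution runs on the same curve with the same affine
  \<open>curve_time\<close>. Positivity of \<open>curve_time\<close> keeps it before
  \<open>Tb\<close>, and strict monotonicity identifies the parameters.\<close>

lemma asymmetric_solution:
  assumes "0 < C0" "C0 < A0" "0 < B0"
  shows "\<exists>Tb>0. \<exists>A B C. maximal_diag_solution A0 B0 C0 (ereal Tb) A B C
    \<and> (\<exists>\<eta>1>0. \<exists>\<eta>2>0. \<exists>\<eta>3>0.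
        A \<sim>[at_left Tb] (\<lambda>t. \<eta>1 * (Tb - t) powr (- 1 / 14))
      \<and> B \<sim>[at_left Tb] (\<lambda>t. \<eta>2 * (Tb - t) powr (3 / 14))
      \<and> C \<sim>[at_left Tb] (\<lambda>t. \<eta>3 * (Tb - t) powr (3 / 14)))"
proof -
  \<comment> \<open>\<open>a\<close> and \<open>b\<close> are chosen so that the initial values of
    the conserved quantities are \<open>a ^ 4\<close> and
    \<open>a\<^sup>2 * b\<^sup>2\<close>.\<close>
  define a where "a = root 4 (A0 * C0 * (A0 - C0)\<^sup>2)"
  have a: "0 < a" "A0 * C0 * (A0 - C0)\<^sup>2 = a ^ 4"
    using assms by (simp_all add: a_def)
  define b where "b = sqrt (B0\<^sup>2 * (A0 + C0) ^ 4 / (A0 * C0)) / a"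
  have b: "0 < b" "B0\<^sup>2 * (A0 + C0) ^ 4 / (A0 * C0) = a\<^sup>2 * b\<^sup>2"
    using assms a(1) by (simp_all add: b_def power_divide)
  define s0 where "s0 = root 4 (C0 / A0)"
  have s0: "0 < s0" "s0 ^ 4 = C0 / A0"
    using assms by (simp_all add: s0_def)
  note c0 = curve_of_metric[OF assms(1,2,3) a(1) b(1) s0 a(2) b(2)]
  define c where "c = 2 / b\<^sup>2"
  have c: "0 < c" using b by (simp add: c_def)
  \<comment> \<open>The time at which \<open>curve_time\<close>, decreasing from
    \<open>curve_time s0\<close> at speed \<open>c\<close>, reaches 0.\<close>
  define Tb where "Tb = curve_time s0 / c"
  have Tb: "0 < Tb" "c * Tb = curve_time s0"
    using c curve_time_strict_mono[of 0 s0] s0 by (simp_all add: Tb_def)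
  obtain s where s_init: "s 0 = s0"
    and s: "\<And>t. 0 \<le> t \<Longrightarrow> t < Tb \<Longrightarrow> 0 < s t \<and> s t < 1 \<and> curve_time (s t) = c * (Tb - t)
      \<and> (s has_real_derivative - (c / curve_weight (s t))) (at t)"
    using curve_time_inverse[OF c s0(1) c0(1)] unfolding Tb_def by metis
  let ?A = "\<lambda>t. curve_A a (s t)" and ?B = "\<lambda>t. curve_B b (s t)" and ?C = "\<lambda>t. curve_C a (s t)"
  have max: "maximal_diag_solution A0 B0 C0 (ereal Tb) ?A ?B ?C"
    unfolding maximal_diag_solution_def
  proof (intro conjI allI impI)
    have "xcf_ode_on (time_interval (ereal Tb)) ?A ?B ?C"
      using a(1) b(1) s unfolding c_def
      by (intro xcf_ode_on_curve) (auto simp: time_interval_def intro: has_field_derivative_at_within)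
    then show "diag_solution A0 B0 C0 (ereal Tb) ?A ?B ?C"
      unfolding diag_solution_iff using Tb s_init c0 by simp
    fix T' A' B' C'
    assume "diag_solution A0 B0 C0 T' A' B' C'"
    then have T': "0 < T'" and init: "A' 0 = A0" "B' 0 = B0" "C' 0 = C0"
      and ode: "xcf_ode_on (time_interval T') A' B' C'"
      unfolding diag_solution_iff by auto
    define s' where "s' t = root 4 (C' t / A' t)" for t
    have s'0: "s' 0 = s0" by (simp add: s'_def init s0_def)
    have s': "0 < s' t" "A' t = curve_A a (s' t)" "B' t = curve_B b (s' t)" "C' t = curve_C a (s' t)"
      "curve_time (s' t) = c * (Tb - t)" if "t \<in> time_interval T'" for t
      using xcf_solution_on_curve[OF ode _ a(1) b(1) _ _ that] assms(2) a(2) b(2) Tb(2) s'0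
      unfolding init s'_def[symmetric] c_def[symmetric] by (simp_all add: right_diff_distrib s0_def)
    have less: "t < Tb" if "t \<in> time_interval T'" for t
    proof -
      have "0 < c * (Tb - t)"
        using s'(1,5)[OF that] curve_time_strict_mono[of 0 "s' t"] by simp
      then show ?thesis using c by (simp add: zero_less_mult_iff)
    qed
    show "T' \<le> ereal Tb"
    proof (rule ccontr)
      assume "\<not> T' \<le> ereal Tb"
      then have "Tb \<in> time_interval T'" using Tb by (simp add: time_interval_def)
      from less[OF this] show False by simp
    qed
    show "\<forall>t\<in>time_interval T'. A' t = ?A t \<and> B' t = ?B t \<and> C' t = ?C t"
    proof
      fix t assume t: "t \<in> time_interval T'"
      then have "0 < s t" "curve_time (s t) = curve_time (s' t)"
        using s[of t] less[OF t] s'(5)[OF t] by (auto simp: time_interval_def)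
      then have "s' t = s t"
        using curve_time_strict_mono[of "s t" "s' t"] curve_time_strict_mono[of "s' t" "s t"] s'(1)[OF t]
        by (cases "s t" "s' t" rule: linorder_cases) auto
      then show "A' t = ?A t \<and> B' t = ?B t \<and> C' t = ?C t"
        using s'(2-4)[OF t] by simp
    qed
  qed
  define k where "k = (14 * c) powr (1 / 14)"
  have k: "0 < k" using c by (simp add: k_def)
  note lims = curve_parameter_asymp[OF c Tb(1), of s, folded k_def]
  have "?A \<sim>[at_left Tb] (\<lambda>t. a / k * (Tb - t) powr (- 1 / 14))"
    "?B \<sim>[at_left Tb] (\<lambda>t. b * k ^ 3 * (Tb - t) powr (3 / 14))"
    "?C \<sim>[at_left Tb] (\<lambda>t. a * k ^ 3 * (Tb - t) powr (3 / 14))"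
    using curve_asymp[OF a(1) b(1) k lims] s by blast+
  moreover have "0 < a / k" "0 < b * k ^ 3" "0 < a * k ^ 3"
    using a b k by simp_all
  ultimately have ex: "\<exists>\<eta>1>0. \<exists>\<eta>2>0. \<exists>\<eta>3>0. ?A \<sim>[at_left Tb] (\<lambda>t. \<eta>1 * (Tb - t) powr (- 1 / 14))
      \<and> ?B \<sim>[at_left Tb] (\<lambda>t. \<eta>2 * (Tb - t) powr (3 / 14))
      \<and> ?C \<sim>[at_left Tb] (\<lambda>t. \<eta>3 * (Tb - t) powr (3 / 14))"
    by (intro exI conjI)
  show ?thesis
    by (rule exI[of _ Tb], rule conjI[OF Tb(1)], rule exI[of _ ?A], rule exI[of _ ?B], rule exI[of _ ?C],
        rule conjI[OF max ex])
qed

theorem theorem4p5: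
  fixes A0 B0 C0 :: real
  assumes "0 < A0" "0 < B0" "0 < C0" "A0 \<ge> C0"
  shows "(A0 = C0 \<longrightarrow>
           maximal_diag_solution A0 B0 C0 \<infinity>
             (\<lambda>t. A0 * B0 / sqrt (B0\<^sup>2 + 64 * t))
             (\<lambda>t. sqrt (B0\<^sup>2 + 64 * t))
             (\<lambda>t. A0 * B0 / sqrt (B0\<^sup>2 + 64 * t)))
       \<and> (A0 > C0 \<longrightarrow>
           (\<exists>Tb>0. \<exists>A B C. maximal_diag_solution A0 B0 C0 (ereal Tb) A B C
             \<and> (\<exists>\<eta>1>0. \<exists>\<eta>2>0. \<exists>\<eta>3>0.
                 A \<sim>[at_left Tb] (\<lambda>t. \<eta>1 * (Tb - t) powr (- 1 / 14))
               \<and> B \<sim>[at_left Tb] (\<lambda>t. \<eta>2 * (Tb - t) powr (3 / 14))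
               \<and> C \<sim>[at_left Tb] (\<lambda>t. \<eta>3 * (Tb - t) powr (3 / 14)))))"
proof (intro conjI impI)
  show "maximal_diag_solution A0 B0 C0 \<infinity> (\<lambda>t. A0 * B0 / sqrt (B0\<^sup>2 + 64 * t))
      (\<lambda>t. sqrt (B0\<^sup>2 + 64 * t)) (\<lambda>t. A0 * B0 / sqrt (B0\<^sup>2 + 64 * t))" if "A0 = C0"
    using symmetric_solution[OF assms(1,2)] unfolding that .
qed (rule asymmetric_solution[OF assms(3) _ assms(2)])

end
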